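(* Suppose that $g>1$ and $\alpha_1,\dots,\alpha_{2g+1}\in\mathbb{C}$ are algebraically independent (transcendental) elements of $\mathbb{C}$ over $\mathbb{Q}$ (i.e., $\mathcal{C}:y^2=\prod_{i=1}^{2g+1}(x-\alpha_i)$ is a generic hyperelliptic curve). Then: (i) $\Theta_{[2g/3]}(\mathbb{C})$ does not contain nonzero points of odd order. (ii) All $2$-power torsion points in $\Theta_{[g/2]}(\mathbb{C})$ have order $1$ or $2$.
   Context: $\mathcal{C}$ is the smooth projective model over $\mathbb{C}$ of the affine curve $y^2=\prod_{i=1}^{2g+1}(x-\alpha_i)$; it is a genus $g$ hyperelliptic curve with exactly one infinite point $\infty$. $J$ is its jacobian, and $\mathcal{C}$ is identified with its image in $J$ under $P\mapsto\mathrm{cl}((P)-(\infty))$, where $\mathrm{cl}$ denotes linear equivalence class; $\infty$ goes to the zero of $J$. For a positive integer $d\le g$, $\Theta_d\subset J$ is the image of the map $\mathcal{C}^d\to J$, $(Q_1,\dots,Q_d)\mapsto\sum_{i=1}^dQ_i$ (sum in $J$). $[\cdot]$ denotes the integer part. Orders are orders of elements of the group $J(\mathbb{C})$. *)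

theory Defs
  imports
    "HOL-Computational_Algebra.Polynomial_Factorial"
    "HOL-Algebra.Multiplicative_Group"
    "HOL-Algebra.Free_Abelian_Groups"
begin

text \<open>
  Throughout, \<open>f\<close> is meant to be a squarefree complex polynomial of odd degree \<open>2g+1\<close>.
  The smooth projective model of \<open>y^2 = f(x)\<close> is covered by the affine curve itself and the
  chart with coordinates \<open>s = 1/x\<close>, \<open>w = y/x^(g+1)\<close>, in which it is
  \<open>w^2 = s^(2g+2) f(1/s)\<close>; the only point of the second chart with \<open>s = 0\<close> is
  \<open>(s, w) = (0, 0)\<close>, the point at infinity.
\<close>

datatype curve_point = Affine complex complex | Infinity

definition hyperelliptic_curve :: "complex poly \<Rightarrow> curve_point set" where
  "hyperelliptic_curve f = insert Infinity {Affine a b | a b. b ^ 2 = poly f a}"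

text \<open>
  The field of rational functions \<open>\<complex>(x)[y]/(y^2 - f)\<close>: the pair \<open>(u, v)\<close> stands for \<open>u + v y\<close>
  with \<open>u, v\<close> in \<open>\<complex>(x)\<close>.
\<close>

type_synonym ratfun = "complex poly fract \<times> complex poly fract"

definition function_field :: "complex poly \<Rightarrow> ratfun ring" where
  "function_field f =
     \<lparr>carrier = UNIV,
      monoid.mult = (\<lambda>(u, v) (u', v'). (u * u' + to_fract f * v * v', u * v' + v * u')),
      one = (1, 0),
      ring.zero = (0, 0),
      ring.add = (\<lambda>(u, v) (u', v'). (u + u', v + v'))\<rparr>"

text \<open>
  \<open>chart_fun f P p q\<close> is the polynomial function \<open>p(\<xi>) + q(\<xi>) \<eta>\<close>, where \<open>(\<xi>, \<eta>)\<close> are the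
  coordinates of the chart chosen around \<open>P\<close>: \<open>(x, y)\<close> at affine points and
  \<open>(1/x, y/x^(g+1))\<close> at infinity, where \<open>g + 1 = (degree f + 1) div 2\<close>. Since \<open>\<eta>^2\<close> is a
  polynomial in \<open>\<xi>\<close>, these are all polynomials in \<open>\<xi>, \<eta>\<close>. \<open>chart_val P p q\<close> is the value of
  that function at \<open>P\<close>.
\<close>

definition poly_at :: "complex poly \<Rightarrow> complex poly fract \<Rightarrow> complex poly fract" where
  "poly_at p r = poly (map_poly (\<lambda>c. to_fract [:c:]) p) r"

fun chart_fun :: "complex poly \<Rightarrow> curve_point \<Rightarrow> complex poly \<Rightarrow> complex poly \<Rightarrow> ratfun" where
  "chart_fun f (Affine a b) p q = (to_fract p, to_fract q)"
| "chart_fun f Infinity p q =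
     (let s = inverse (to_fract [:0, 1:])
      in (poly_at p s, poly_at q s * s ^ ((degree f + 1) div 2)))"

fun chart_val :: "curve_point \<Rightarrow> complex poly \<Rightarrow> complex poly \<Rightarrow> complex" where
  "chart_val (Affine a b) p q = poly p a + poly q a * b"
| "chart_val Infinity p q = poly p 0"

definition local_ring :: "complex poly \<Rightarrow> curve_point \<Rightarrow> ratfun set" where
  "local_ring f P =
     {h. \<exists>p q p' q'. chart_val P p' q' \<noteq> 0 \<and>
           h \<otimes>\<^bsub>function_field f\<^esub> chart_fun f P p' q' = chart_fun f P p q}"

definition local_units :: "complex poly \<Rightarrow> curve_point \<Rightarrow> ratfun set" where
  "local_units f P =
     {u \<in> local_ring f P. \<exists>v \<in> local_ring f P. u \<otimes>\<^bsub>function_field f\<^esub> v = \<one>\<^bsub>function_field f\<^esub>}"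

definition uniformizer :: "complex poly \<Rightarrow> curve_point \<Rightarrow> ratfun \<Rightarrow> bool" where
  "uniformizer f P t \<longleftrightarrow>
     local_ring f P - local_units f P = (\<lambda>h. t \<otimes>\<^bsub>function_field f\<^esub> h) ` local_ring f P"

text \<open>Order of vanishing at \<open>P\<close>; only meaningful for \<open>h \<noteq> 0\<close>.\<close>

definition ord_at :: "complex poly \<Rightarrow> curve_point \<Rightarrow> ratfun \<Rightarrow> int" where
  "ord_at f P h =
     (THE n. \<exists>t u. uniformizer f P t \<and> u \<in> local_units f P \<and>
        h = (t [^]\<^bsub>function_field f\<^esub> n) \<otimes>\<^bsub>function_field f\<^esub> u)"

definition divisor_degree :: "(curve_point \<Rightarrow>\<^sub>0 int) \<Rightarrow> int" where
  "divisor_degree D = (\<Sum>P\<in>Poly_Mapping.keys D. Poly_Mapping.lookup D P)"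

definition degree_zero_divisors :: "complex poly \<Rightarrow> (curve_point \<Rightarrow>\<^sub>0 int) monoid" where
  "degree_zero_divisors f =
     (free_Abelian_group (hyperelliptic_curve f))
       \<lparr>carrier := {D \<in> carrier (free_Abelian_group (hyperelliptic_curve f)). divisor_degree D = 0}\<rparr>"

definition principal_divisors :: "complex poly \<Rightarrow> (curve_point \<Rightarrow>\<^sub>0 int) set" where
  "principal_divisors f =
     {D \<in> carrier (free_Abelian_group (hyperelliptic_curve f)).
        \<exists>h. h \<noteq> \<zero>\<^bsub>function_field f\<^esub> \<and>
          (\<forall>P \<in> hyperelliptic_curve f. Poly_Mapping.lookup D P = ord_at f P h)}"

text \<open>The group of complex points of the jacobian, as degree zero divisor classes.\<close>

definition jacobian :: "complex poly \<Rightarrow> (curve_point \<Rightarrow>\<^sub>0 int) set monoid" where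
  "jacobian f = degree_zero_divisors f Mod principal_divisors f"

definition divisor_class :: "complex poly \<Rightarrow> (curve_point \<Rightarrow>\<^sub>0 int) \<Rightarrow> (curve_point \<Rightarrow>\<^sub>0 int) set" where
  "divisor_class f D = principal_divisors f #>\<^bsub>degree_zero_divisors f\<^esub> D"

definition curve_embedding :: "complex poly \<Rightarrow> curve_point \<Rightarrow> (curve_point \<Rightarrow>\<^sub>0 int) set" where
  "curve_embedding f P = divisor_class f (frag_of P - frag_of Infinity)"

definition Theta :: "complex poly \<Rightarrow> nat \<Rightarrow> (curve_point \<Rightarrow>\<^sub>0 int) set set" where
  "Theta f d =
     {finprod (jacobian f) (\<lambda>i. curve_embedding f (Q i)) {1..d} | Q.
        Q \<in> {1..d} \<rightarrow> hyperelliptic_curve f}"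

text \<open>
  Polynomials over \<open>\<rat>\<close> in variables \<open>X i\<close> (\<open>i\<close> a natural number) are finitely supported maps from
  monomials, i.e. finitely supported exponent vectors, to coefficients.
\<close>

definition mpoly_eval :: "((nat \<Rightarrow>\<^sub>0 nat) \<Rightarrow>\<^sub>0 rat) \<Rightarrow> (nat \<Rightarrow> complex) \<Rightarrow> complex" where
  "mpoly_eval p x =
     (\<Sum>m\<in>Poly_Mapping.keys p. of_rat (Poly_Mapping.lookup p m) *
        (\<Prod>i\<in>Poly_Mapping.keys m. x i ^ Poly_Mapping.lookup m i))"

definition algebraically_independent :: "nat set \<Rightarrow> (nat \<Rightarrow> complex) \<Rightarrow> bool" where
  "algebraically_independent I x \<longleftrightarrow>
     (\<forall>p. (\<forall>m\<in>Poly_Mapping.keys p. Poly_Mapping.keys m \<subseteq> I) \<longrightarrow> mpoly_eval p x = 0 \<longrightarrow> p = 0)"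

end

theory Submission
  imports Defs
    "HOL-Computational_Algebra.Fundamental_Theorem_Algebra"
    "HOL-Algebra.Algebraic_Closure_Type"
begin

text \<open>
  Write \<open>\<iota> (x, y) = (x, - y)\<close>.  The theorem is a consequence of a stronger fact: on a generic curve
  of genus \<open>g\<close>, every torsion point of \<open>\<Theta>\<^sub>d\<close> with \<open>d < g\<close> is killed by \<open>2\<close>
  (\<open>generic_torsion_in_theta\<close>).

  Let \<open>D = Q\<^sub>1 + \<dots> + Q\<^sub>d - d \<infinity>\<close> have a class of finite order.  Some even multiple \<open>N D\<close> is
  the divisor of a function.  Dividing this function by a function of \<open>x\<close> alone removes all pairs
  \<open>P + \<iota> P\<close> from its divisor, hence also the branch points, which occur with even multiplicity
  \<open>N m = (N/2) m + (N/2) m\<close>.  What remains is \<open>A + B y\<close> with polynomials \<open>A\<close>, \<open>B\<close> that have no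
  common root, and all zeros of its norm have multiplicity divisible by \<open>N\<close>.  So
  \<open>A\<^sup>2 - f B\<^sup>2 = U ^ N\<close> with \<open>degree U \<le> d\<close> (\<open>norm_is_power\<close>).

  For generic \<open>f\<close> and \<open>degree U < g\<close>, this Pell equation forces \<open>B = 0\<close>
  (\<open>generic_pell_equation\<close>).  The reason is an infinitesimal count of parameters.  A derivation
  \<open>\<delta>\<close> of \<open>\<complex>\<close> acts on the function field with \<open>\<delta> x = 0\<close>, and the logarithmic derivative of
  \<open>(A + B y) / (A - B y)\<close> is \<open>W y / (f U ^ N)\<close> for a polynomial \<open>W\<close>
  (\<open>log_deriv_numerator\<close>).  Since a logarithmic derivative has only simple poles, \<open>U ^ (N - 1)\<close>
  divides \<open>W\<close>, and the quotient has degree at most \<open>g + degree U < 2 g\<close>.  As the \<open>\<alpha> i\<close> are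
  algebraically independent, there is a derivation \<open>\<delta>\<^sub>i\<close> of \<open>\<complex>\<close> with \<open>\<delta>\<^sub>i (\<alpha> j) = 1\<close> for \<open>i = j\<close>
  and \<open>0\<close> otherwise (\<open>algebraically_independent_derivation\<close>).  These \<open>2 g + 1\<close> derivations
  produce \<open>2 g + 1\<close> polynomials in a space of dimension \<open>2 g\<close>, so \<open>W = 0\<close> for some nontrivial linear
  combination \<open>\<delta>\<close>.  But such a \<open>\<delta>\<close> moves some root \<open>\<alpha> k\<close> of \<open>f\<close>, and then the lowest term of \<open>W\<close> at
  \<open>\<alpha> k\<close> does not vanish if \<open>B \<noteq> 0\<close> (\<open>log_deriv_numerator_nonzero\<close>).

  Hence \<open>B = 0\<close>, the function with divisor \<open>N D\<close> depends on \<open>x\<close> only, the multiset of the \<open>Q\<^sub>i\<close> is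
  invariant under \<open>\<iota>\<close>, and \<open>2 D = D + \<iota> D\<close> is the divisor of the product of the \<open>x - x(Q\<^sub>i)\<close> over the
  affine \<open>Q\<^sub>i\<close>.

  The link with the definition of the jacobian is a uniform description of the local rings: around each
  point, at infinity included, the curve has an equation \<open>\<eta>\<^sup>2 = F(\<xi>)\<close>, and the orders of vanishing
  are computed once for all such charts (\<open>curve_chart\<close>).
\<close>

hide_const (open) up_ring.coeff up_ring.monom module.smult Coset.order
  Polynomials.degree Polynomials.lead_coeff ring.coeff ring.monom

section \<open>Extending derivations\<close>

definition derivation :: "('a::comm_ring_1 \<Rightarrow> 'a) \<Rightarrow> bool" where
  "derivation \<delta> \<longleftrightarrow>
     (\<forall>x y. \<delta> (x + y) = \<delta> x + \<delta> y) \<and> (\<forall>x y. \<delta> (x * y) = \<delta> x * y + x * \<delta> y)"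

text \<open>
  The ring of dual numbers \<open>R[\<epsilon>] / (\<epsilon>\<^sup>2)\<close>.  A map \<open>\<delta>\<close> is a derivation iff \<open>x \<mapsto> x + \<delta> x \<epsilon>\<close> is a ring
  homomorphism, so a derivation defined on a subring of \<open>R\<close> amounts to a subring of the dual numbers that is the graph of
  a function.
\<close>

datatype 'a dual = Dual (re_part: 'a) (eps_part: 'a)

instantiation dual :: (comm_ring_1) comm_ring_1
begin

definition "0 = Dual 0 0"
definition "1 = Dual 1 0"
definition "u + v = Dual (re_part u + re_part v) (eps_part u + eps_part v)"
definition "u - v = Dual (re_part u - re_part v) (eps_part u - eps_part v)"
definition "- u = Dual (- re_part u) (- eps_part u)" for u :: "'a dual"
definition "u * v = Dual (re_part u * re_part v) (eps_part u * re_part v + re_part u * eps_part v)"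

lemmas dual_ring_defs = zero_dual_def one_dual_def plus_dual_def minus_dual_def
  uminus_dual_def times_dual_def

instance
  by standard (auto simp: dual_ring_defs algebra_simps)

end

lemma dual_parts [simp]:
  fixes u v :: "'a::comm_ring_1 dual"
  shows "re_part 0 = (0::'a)" "eps_part 0 = (0::'a)" "re_part 1 = (1::'a)" "eps_part 1 = (0::'a)"
    "re_part (u + v) = re_part u + re_part v" "eps_part (u + v) = eps_part u + eps_part v"
    "re_part (u - v) = re_part u - re_part v" "eps_part (u - v) = eps_part u - eps_part v"
    "re_part (- u) = - re_part u" "eps_part (- u) = - eps_part u"
    "re_part (u * v) = re_part u * re_part v"
    "eps_part (u * v) = eps_part u * re_part v + re_part u * eps_part v"
  by (simp_all add: dual_ring_defs)

lemma dual_eq_iff: "u = v \<longleftrightarrow> re_part u = re_part v \<and> eps_part u = eps_part v"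
  by (cases u; cases v) auto

lemma re_part_power [simp]: "re_part (u ^ n) = re_part u ^ n" for u :: "'a::comm_ring_1 dual"
  by (induction n) auto

lemma re_part_sum: "re_part (sum h A) = (\<Sum>i\<in>A. re_part (h i))"
  for h :: "_ \<Rightarrow> 'a::comm_ring_1 dual"
  by (induction A rule: infinite_finite_induct) auto

lemma re_part_prod: "re_part (prod h A) = (\<Prod>i\<in>A. re_part (h i))"
  for h :: "_ \<Rightarrow> 'a::comm_ring_1 dual"
  by (induction A rule: infinite_finite_induct) auto

lemma re_part_of_nat [simp]: "re_part (of_nat n) = (of_nat n :: 'a::comm_ring_1)"
  by (induction n) auto

lemma dual_unit_cancel:
  fixes u v :: "'a::field dual"
  assumes "re_part u \<noteq> 0" "u * v = 0"
  shows "v = 0"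
  using assms by (auto simp: dual_eq_iff)

definition subring_of :: "'r::comm_ring_1 set \<Rightarrow> bool" where
  "subring_of S \<longleftrightarrow> 1 \<in> S \<and> (\<forall>x\<in>S. \<forall>y\<in>S. x - y \<in> S \<and> x * y \<in> S)"

lemma subring_ofD:
  assumes "subring_of S"
  shows "1 \<in> S" "0 \<in> S" "\<And>x y. x \<in> S \<Longrightarrow> y \<in> S \<Longrightarrow> x - y \<in> S"
    "\<And>x y. x \<in> S \<Longrightarrow> y \<in> S \<Longrightarrow> x * y \<in> S" "\<And>x. x \<in> S \<Longrightarrow> - x \<in> S"
    "\<And>x y. x \<in> S \<Longrightarrow> y \<in> S \<Longrightarrow> x + y \<in> S"
proof -
  show 1: "1 \<in> S" "\<And>x y. x \<in> S \<Longrightarrow> y \<in> S \<Longrightarrow> x - y \<in> S"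
    "\<And>x y. x \<in> S \<Longrightarrow> y \<in> S \<Longrightarrow> x * y \<in> S"
    using assms by (auto simp: subring_of_def)
  show z: "0 \<in> S" using 1(2)[OF 1(1) 1(1)] by simp
  show m: "\<And>x. x \<in> S \<Longrightarrow> - x \<in> S" using 1(2)[OF z] by simp
  show "\<And>x y. x \<in> S \<Longrightarrow> y \<in> S \<Longrightarrow> x + y \<in> S" using 1(2) m by (metis diff_minus_eq_add)
qed

lemma subring_of_sum:
  assumes "subring_of S" "\<And>i. i \<in> A \<Longrightarrow> h i \<in> S"
  shows "sum h A \<in> S"
  using assms(2) by (induction A rule: infinite_finite_induct) (auto simp: subring_ofD[OF assms(1)])

lemma subring_of_nat:
  assumes "subring_of S"
  shows "of_nat n \<in> S"
  by (induction n) (auto simp: subring_ofD[OF assms])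

definition poly_over :: "'r::comm_ring_1 set \<Rightarrow> 'r poly \<Rightarrow> bool" where
  "poly_over S p \<longleftrightarrow> (\<forall>i. coeff p i \<in> S)"

lemma poly_over_closed:
  assumes "subring_of S" "poly_over S p" "poly_over S q"
  shows "poly_over S (p - q)" "poly_over S (p * q)"
  using assms by (auto simp: poly_over_def coeff_mult intro!: subring_of_sum subring_ofD)

lemma poly_over_monom:
  assumes "subring_of S" "c \<in> S"
  shows "poly_over S (monom c n)"
  using assms by (auto simp: poly_over_def subring_ofD)

lemma subring_of_adjoin:
  assumes "subring_of S"
  shows "subring_of {poly p u | p. poly_over S p}"
  unfolding subring_of_def
proof (intro conjI ballI)
  show "1 \<in> {poly p u | p. poly_over S p}"
    using subring_ofD(1,2)[OF assms]
    by (intro CollectI exI[of _ 1]) (auto simp: poly_over_def)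
  fix x y assume "x \<in> {poly p u | p. poly_over S p}" "y \<in> {poly p u | p. poly_over S p}"
  then obtain p q where "poly_over S p" "poly_over S q" "x = poly p u" "y = poly q u" by blast
  then show "x - y \<in> {poly p u | p. poly_over S p}" "x * y \<in> {poly p u | p. poly_over S p}"
    using poly_over_closed[OF assms, of p q] poly_diff[of p q u] poly_mult[of p q u]
    by (force intro: exI[of _ "p - q"], force intro: exI[of _ "p * q"])
qed

text \<open>
  The graph of a derivation defined on a subring: as the set is closed under differences, the
  condition on elements with vanishing real part says that it is the graph of a function.
\<close>

definition partial_derivation :: "'a::field dual set \<Rightarrow> bool" where
  "partial_derivation S \<longleftrightarrow> subring_of S \<and> (\<forall>s\<in>S. re_part s = 0 \<longrightarrow> s = 0)"

lemma power_add_nilsquare: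
  fixes x e :: "'r::comm_ring_1"
  assumes "e * e = 0"
  shows "(x + e) ^ n = x ^ n + of_nat n * e * x ^ (n - 1)"
proof (induction n)
  case (Suc n)
  have 0: "e * (e * y) = 0" for y using assms by (simp add: mult.assoc[symmetric])
  have "x * (of_nat n * (e * x ^ (n - 1))) = of_nat n * (e * x ^ n)"
    by (cases n) (auto simp: algebra_simps)
  then show ?case
    using Suc by (simp add: algebra_simps 0)
qed simp

text \<open>
  The derivative of a polynomial over a ring with zero divisors; the operation \<open>pderiv\<close> is defined only
  over rings without them.
\<close>

definition formal_deriv :: "'r::comm_ring_1 poly \<Rightarrow> 'r poly" where
  "formal_deriv p = (\<Sum>i\<le>degree p. monom (of_nat i * coeff p i) (i - 1))"

lemma coeff_formal_deriv: "coeff (formal_deriv p) k = of_nat (Suc k) * coeff p (Suc k)"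
proof -
  have "coeff (formal_deriv p) k = (\<Sum>i\<le>degree p. if i = Suc k then of_nat i * coeff p i else 0)"
    unfolding formal_deriv_def coeff_sum
    by (intro sum.cong refl) (auto simp: Suc_diff_le split: nat_diff_split)
  also have "\<dots> = of_nat (Suc k) * coeff p (Suc k)"
    using coeff_eq_0[of p "Suc k"] by (simp add: not_le)
  finally show ?thesis .
qed

lemma poly_add_nilsquare:
  fixes x e :: "'r::comm_ring_1"
  assumes "e * e = 0"
  shows "poly p (x + e) = poly p x + e * poly (formal_deriv p) x"
proof -
  have "poly p (x + e) = (\<Sum>i\<le>degree p. coeff p i * (x ^ i + of_nat i * e * x ^ (i - 1)))"
    by (simp add: poly_altdef power_add_nilsquare[OF assms])
  also have "\<dots> = poly p x + e * poly (formal_deriv p) x"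
    unfolding formal_deriv_def poly_sum poly_monom poly_altdef[of p]
    by (simp add: algebra_simps sum.distrib sum_distrib_left)
  finally show ?thesis .
qed

text \<open>
  A derivation on \<open>S\<close> extends to \<open>S[z]\<close>.  If \<open>z\<close> is transcendental, any value at \<open>z\<close> will do.  If
  \<open>z\<close> is algebraic with minimal polynomial \<open>P\<close>, the value \<open>w\<close> at \<open>z\<close> is determined by
  \<open>P(z + w \<epsilon>) = 0\<close>, which is solvable as \<open>P'(z) \<noteq> 0\<close> in characteristic zero; every other polynomial that
  vanishes at \<open>z\<close> then also vanishes at \<open>z + w \<epsilon>\<close>, by division with remainder by \<open>P\<close>.
\<close>

lemma partial_derivation_extend:
  fixes S :: "'a::field_char_0 dual set"
  assumes S: "partial_derivation S"
  shows "\<exists>w. partial_derivation {poly p (Dual z w) | p. poly_over S p}"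
proof -
  have sub: "subring_of S" and inj: "\<And>s. s \<in> S \<Longrightarrow> re_part s = 0 \<Longrightarrow> s = 0"
    using S by (auto simp: partial_derivation_def)
  have re_indep: "re_part (poly p (Dual z w)) = re_part (poly p (Dual z 0))" for p :: "'a dual poly" and w
    by (induction p) auto
  define annih where "annih = (\<lambda>p. poly_over S p \<and> p \<noteq> 0 \<and> re_part (poly p (Dual z 0)) = 0)"
  show ?thesis
  proof (cases "\<exists>p. annih p")
    case False
    then have "poly p (Dual z 0) = 0" if "poly_over S p" "re_part (poly p (Dual z 0)) = 0" for p
      using that by (cases "p = 0") (auto simp: annih_def)
    then have "partial_derivation {poly p (Dual z 0) | p. poly_over S p}"
      using subring_of_adjoin[OF sub] by (auto simp: partial_derivation_def)
    then show ?thesis by blast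
  next
    case True
    define P where "P = arg_min degree annih"
    have P: "annih P" using True arg_min_natI[of annih] unfolding P_def by blast
    have min: "p = 0" if "poly_over S p" "re_part (poly p (Dual z 0)) = 0" "degree p < degree P" for p
      using that arg_min_nat_le[of annih p degree] unfolding P_def annih_def by fastforce
    define l where "l = lead_coeff P"
    have l: "l \<in> S" "re_part l \<noteq> 0"
      using P inj[of l] unfolding annih_def l_def poly_over_def by auto
    have deg: "degree P > 0"
    proof (rule ccontr)
      assume "\<not> degree P > 0"
      then obtain c where "P = [:c:]" by (auto elim: degree_eq_zeroE)
      then show False using P inj[of c] by (auto simp: annih_def poly_over_def split: nat.splits)
          (metis coeff_pCons_0)
    qed
    define e where "e = re_part (poly (formal_deriv P) (Dual z 0))"
    have e: "e \<noteq> 0"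
    proof
      assume "e = 0"
      have "poly_over S (formal_deriv P)"
        using P by (auto simp: poly_over_def coeff_formal_deriv annih_def simp del: of_nat_Suc
            intro!: subring_ofD(4)[OF sub] subring_of_nat[OF sub])
      moreover have "degree (formal_deriv P) < degree P"
      proof -
        have "degree (formal_deriv P) \<le> degree P - 1"
          by (rule degree_le) (use deg in \<open>auto simp: coeff_formal_deriv coeff_eq_0\<close>)
        then show ?thesis using deg by simp
      qed
      ultimately have "formal_deriv P = 0" using min \<open>e = 0\<close> by (simp add: e_def)
      then have "coeff (formal_deriv P) (degree P - 1) = 0" by simp
      then have "of_nat (degree P) * l = 0"
        using deg by (simp add: coeff_formal_deriv l_def del: of_nat_Suc)
      then have "re_part (of_nat (degree P) * l) = 0" by simp
      then show False using l deg by simp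
    qed
    define w where "w = - eps_part (poly P (Dual z 0)) / e"
    have Pw: "poly P (Dual z w) = 0"
    proof -
      have "Dual z w = Dual z 0 + Dual 0 w" by (simp add: dual_eq_iff)
      moreover have "Dual 0 w * Dual 0 w = (0::'a dual)" by (simp add: dual_eq_iff)
      ultimately have "poly P (Dual z w) = poly P (Dual z 0) + Dual 0 w * poly (formal_deriv P) (Dual z 0)"
        by (simp add: poly_add_nilsquare)
      then show ?thesis
        using P e by (simp add: dual_eq_iff annih_def e_def[symmetric] w_def)
    qed
    have "poly q (Dual z w) = 0" if "poly_over S q" "re_part (poly q (Dual z w)) = 0" for q
      using that
    proof (induction "degree q" arbitrary: q rule: less_induct)
      case less
      show ?case
      proof (cases "degree q < degree P")
        case True
        then show ?thesis using min[of q] less.prems by (simp add: re_indep[of _ w])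
      next
        case False
        \<comment> \<open>one step of division by \<open>P\<close>; as \<open>P\<close> need not be monic, \<open>q\<close> is multiplied by the leading coefficient \<open>l\<close>, which is no zero divisor\<close>
        define q' where "q' = [:l:] * q - monom (lead_coeff q) (degree q - degree P) * P"
        have over: "poly_over S q'"
          unfolding q'_def
          using l(1) less.prems(1) P sub
          by (intro poly_over_closed poly_over_monom) (auto simp: annih_def poly_over_def coeff_pCons
            subring_ofD split: nat.splits)
        have val: "poly q' (Dual z w) = l * poly q (Dual z w)"
          by (simp add: q'_def Pw)
        have lt: "q' = 0 \<or> degree q' < degree q"
        proof (cases "degree q = 0")
          case True
          with deg False show ?thesis by simp
        next
          case nz: False
          have le: "degree q' \<le> degree q"
            unfolding q'_def
          proof (rule degree_diff_le)
            show "degree ([:l:] * q) \<le> degree q" by (simp add: degree_smult_le)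
            have "degree (monom (lead_coeff q) (degree q - degree P) * P)
                \<le> degree (monom (lead_coeff q) (degree q - degree P)) + degree P" by (rule degree_mult_le)
            also have "\<dots> \<le> degree q" using False degree_monom_le[of "lead_coeff q" "degree q - degree P"] by linarith
            finally show "degree (monom (lead_coeff q) (degree q - degree P) * P) \<le> degree q" .
          qed
          have "coeff q' (degree q) = 0"
            using False by (simp add: q'_def coeff_monom_mult l_def)
          then show ?thesis using le nz
            by (metis eq_zero_or_degree_less)
        qed
        have "poly q' (Dual z w) = 0"
          using lt
        proof
          assume "degree q' < degree q"
          then show ?thesis using less.hyps[of q'] over val less.prems by simp
        qed simp
        then show ?thesis using val l dual_unit_cancel by simp
      qed
    qed
    then have "partial_derivation {poly p (Dual z w) | p. poly_over S p}"
      using subring_of_adjoin[OF sub] by (auto simp: partial_derivation_def)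
    then show ?thesis by blast
  qed
qed

lemma partial_derivation_Union:
  assumes C: "C \<noteq> {}" "subset.chain A C" and pd: "\<And>S. S \<in> C \<Longrightarrow> partial_derivation S"
  shows "partial_derivation (\<Union>C)"
  unfolding partial_derivation_def subring_of_def
proof (intro conjI ballI impI)
  show "1 \<in> \<Union>C" using C(1) pd subring_ofD(1) by (fastforce simp: partial_derivation_def)
next
  fix x y assume "x \<in> \<Union>C" "y \<in> \<Union>C"
  then obtain S where "S \<in> C" "x \<in> S" "y \<in> S"
  proof -
    obtain T Y where "T \<in> C" "Y \<in> C" "x \<in> T" "y \<in> Y" using \<open>x \<in> \<Union>C\<close> \<open>y \<in> \<Union>C\<close> by blast
    moreover from this have "T \<subseteq> Y \<or> Y \<subseteq> T" using C(2) by (auto simp: subset_chain_def)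
    ultimately show thesis using that by blast
  qed
  then show "x - y \<in> \<Union>C" "x * y \<in> \<Union>C"
    using pd[of S] by (auto simp: partial_derivation_def subring_of_def)
next
  fix x assume "x \<in> \<Union>C" "re_part x = 0"
  then show "x = 0" using pd by (auto simp: partial_derivation_def)
qed

text \<open>
  By Zorn's lemma there is a maximal extension, and it is defined everywhere because it could otherwise be
  extended by one more element.
\<close>

theorem derivation_extends:
  fixes S0 :: "'a::field_char_0 dual set"
  assumes "partial_derivation S0"
  shows "\<exists>\<delta>. derivation \<delta> \<and> (\<forall>s\<in>S0. \<delta> (re_part s) = eps_part s)"
proof -
  define \<A> where "\<A> = {S. partial_derivation S \<and> S0 \<subseteq> S}"
  have "\<exists>M\<in>\<A>. \<forall>T\<in>\<A>. M \<subseteq> T \<longrightarrow> T = M"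
  proof (rule subset_Zorn_nonempty)
    show "\<A> \<noteq> {}" using assms by (auto simp: \<A>_def)
    fix C assume C: "C \<noteq> {}" "subset.chain \<A> C"
    then have "C \<subseteq> \<A>" by (auto simp: subset.chain_def)
    then show "\<Union>C \<in> \<A>"
      using C partial_derivation_Union[OF C] by (auto simp: \<A>_def)
  qed
  then obtain M where M: "partial_derivation M" "S0 \<subseteq> M"
    and max: "\<And>T. partial_derivation T \<Longrightarrow> M \<subseteq> T \<Longrightarrow> T = M"
    by (auto simp: \<A>_def)
  have sub: "subring_of M" and inj: "\<And>s. s \<in> M \<Longrightarrow> re_part s = 0 \<Longrightarrow> s = 0"
    using M by (auto simp: partial_derivation_def)
  have "\<exists>w. Dual z w \<in> M" for z
  proof -
    obtain w where w: "partial_derivation {poly p (Dual z w) | p. poly_over M p}" (is "partial_derivation ?T")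
      using partial_derivation_extend[OF M(1)] by blast
    have "M \<subseteq> ?T"
    proof
      fix s assume "s \<in> M"
      then show "s \<in> ?T" using subring_ofD(2)[OF sub]
        by (intro CollectI exI[of _ "[:s:]"]) (auto simp: poly_over_def coeff_pCons split: nat.splits)
    qed
    moreover have "Dual z w \<in> ?T" using subring_ofD(1,2)[OF sub]
        by (intro CollectI exI[of _ "[:0,1:]"]) (auto simp: poly_over_def coeff_pCons split: nat.splits)
    ultimately show ?thesis using max[OF w] by blast
  qed
  then obtain \<delta> where \<delta>: "\<And>z. Dual z (\<delta> z) \<in> M" by metis
  have uniq: "\<delta> (re_part s) = eps_part s" if "s \<in> M" for s
    using inj[of "Dual (re_part s) (\<delta> (re_part s)) - s"] \<delta> that subring_ofD(3)[OF sub]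
    by (auto simp: dual_eq_iff)
  have "derivation \<delta>"
    unfolding derivation_def
  proof (intro conjI allI)
    fix x y
    show "\<delta> (x + y) = \<delta> x + \<delta> y"
      using uniq[OF subring_ofD(6)[OF sub \<delta>[of x] \<delta>[of y]]] by simp
    show "\<delta> (x * y) = \<delta> x * y + x * \<delta> y"
      using uniq[OF subring_ofD(4)[OF sub \<delta>[of x] \<delta>[of y]]] by simp
  qed
  then show ?thesis using uniq M(2) by blast
qed

definition monomial_at :: "(nat \<Rightarrow> 'r::comm_ring_1) \<Rightarrow> (nat \<Rightarrow>\<^sub>0 nat) \<Rightarrow> 'r" where
  "monomial_at x m = (\<Prod>i\<in>Poly_Mapping.keys m. x i ^ Poly_Mapping.lookup m i)"

text \<open>
  Evaluation of multivariate polynomials in an arbitrary coefficient extension; it is needed at points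
  whose coordinates are dual numbers.
\<close>

definition mpoly_at :: "('c::comm_ring_1 \<Rightarrow> 'r::comm_ring_1) \<Rightarrow> (nat \<Rightarrow> 'r) \<Rightarrow> ((nat \<Rightarrow>\<^sub>0 nat) \<Rightarrow>\<^sub>0 'c) \<Rightarrow> 'r" where
  "mpoly_at \<iota> x p = (\<Sum>m\<in>Poly_Mapping.keys p. \<iota> (Poly_Mapping.lookup p m) * monomial_at x m)"

lemma monomial_at_add: "monomial_at x (m + m') = monomial_at x m * monomial_at x m'"
proof -
  let ?K = "Poly_Mapping.keys m \<union> Poly_Mapping.keys m'"
  have ext: "monomial_at x n = (\<Prod>i\<in>?K. x i ^ Poly_Mapping.lookup n i)"
    if "Poly_Mapping.keys n \<subseteq> ?K" for n
    unfolding monomial_at_def using that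
    by (intro prod.mono_neutral_left) (auto simp: in_keys_iff)
  show ?thesis
    using ext[of m] ext[of m'] ext[of "m + m'"] Poly_Mapping.keys_add[of m m']
    by (simp add: lookup_add power_add prod.distrib)
qed

lemma poly_mapping_as_sum:
  "p = (\<Sum>m\<in>Poly_Mapping.keys p. Poly_Mapping.single m (Poly_Mapping.lookup p m))"
proof (rule poly_mapping_eqI)
  fix k
  have "Poly_Mapping.lookup (\<Sum>m\<in>Poly_Mapping.keys p. Poly_Mapping.single m (Poly_Mapping.lookup p m)) k
      = (\<Sum>m\<in>Poly_Mapping.keys p. if m = k then Poly_Mapping.lookup p k else 0)"
    unfolding lookup_sum by (intro sum.cong refl) (auto simp: lookup_single)
  then show "Poly_Mapping.lookup p k
      = Poly_Mapping.lookup (\<Sum>m\<in>Poly_Mapping.keys p. Poly_Mapping.single m (Poly_Mapping.lookup p m)) k"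
    by (simp add: in_keys_iff)
qed

context
  fixes \<iota> :: "'c::comm_ring_1 \<Rightarrow> 'r::comm_ring_1" and x :: "nat \<Rightarrow> 'r"
  assumes hom: "\<iota> 1 = 1" "\<And>a b. \<iota> (a + b) = \<iota> a + \<iota> b" "\<And>a b. \<iota> (a * b) = \<iota> a * \<iota> b"
begin

lemma coeff_hom_0: "\<iota> 0 = 0"
  using hom(2)[of 0 0] by simp

lemma mpoly_at_0: "mpoly_at \<iota> x 0 = 0"
  by (simp add: mpoly_at_def)

lemma mpoly_at_add: "mpoly_at \<iota> x (p + q) = mpoly_at \<iota> x p + mpoly_at \<iota> x q"
proof -
  let ?K = "Poly_Mapping.keys p \<union> Poly_Mapping.keys q"
  have ext: "mpoly_at \<iota> x r = (\<Sum>m\<in>?K. \<iota> (Poly_Mapping.lookup r m) * monomial_at x m)"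
    if "Poly_Mapping.keys r \<subseteq> ?K" for r
    unfolding mpoly_at_def using that
    by (intro sum.mono_neutral_left) (auto simp: in_keys_iff coeff_hom_0)
  show ?thesis
    using ext[of p] ext[of q] ext[of "p + q"] Poly_Mapping.keys_add[of p q]
    by (simp add: lookup_add hom algebra_simps sum.distrib)
qed

lemma mpoly_at_sum: "mpoly_at \<iota> x (sum h A) = (\<Sum>i\<in>A. mpoly_at \<iota> x (h i))"
  by (induction A rule: infinite_finite_induct) (auto simp: mpoly_at_0 mpoly_at_add)

lemma mpoly_at_single: "mpoly_at \<iota> x (Poly_Mapping.single m c) = \<iota> c * monomial_at x m"
  by (cases "c = 0") (auto simp: mpoly_at_def coeff_hom_0)

lemma mpoly_at_mult: "mpoly_at \<iota> x (p * q) = mpoly_at \<iota> x p * mpoly_at \<iota> x q"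
proof -
  have "p * q = (\<Sum>m\<in>Poly_Mapping.keys p. \<Sum>n\<in>Poly_Mapping.keys q.
      Poly_Mapping.single (m + n) (Poly_Mapping.lookup p m * Poly_Mapping.lookup q n))"
    by (subst (1) poly_mapping_as_sum[of p], subst (1) poly_mapping_as_sum[of q])
       (simp add: sum_product mult_single)
  then have "mpoly_at \<iota> x (p * q) = (\<Sum>m\<in>Poly_Mapping.keys p. \<Sum>n\<in>Poly_Mapping.keys q.
      (\<iota> (Poly_Mapping.lookup p m) * monomial_at x m) * (\<iota> (Poly_Mapping.lookup q n) * monomial_at x n))"
    by (simp add: mpoly_at_sum mpoly_at_single monomial_at_add hom algebra_simps)
  also have "\<dots> = mpoly_at \<iota> x p * mpoly_at \<iota> x q"
    by (simp add: mpoly_at_def sum_product)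
  finally show ?thesis .
qed

end

definition mpoly_vars :: "((nat \<Rightarrow>\<^sub>0 nat) \<Rightarrow>\<^sub>0 'c::zero) \<Rightarrow> nat set" where
  "mpoly_vars p = (\<Union>m\<in>Poly_Mapping.keys p. Poly_Mapping.keys m)"

lemma mpoly_vars_ring_ops:
  fixes p q :: "(nat \<Rightarrow>\<^sub>0 nat) \<Rightarrow>\<^sub>0 'c::comm_ring_1"
  assumes "mpoly_vars p \<subseteq> I" "mpoly_vars q \<subseteq> I"
  shows "mpoly_vars (p - q) \<subseteq> I" "mpoly_vars (p * q) \<subseteq> I"
proof -
  have "Poly_Mapping.keys (p - q) \<subseteq> Poly_Mapping.keys p \<union> Poly_Mapping.keys q"
    by (auto simp: in_keys_iff lookup_minus)
  then show "mpoly_vars (p - q) \<subseteq> I"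
    using assms unfolding mpoly_vars_def by blast
  have "Poly_Mapping.keys m \<subseteq> I" if m: "m \<in> Poly_Mapping.keys (p * q)" for m
  proof -
    obtain a b where "a \<in> Poly_Mapping.keys p" "b \<in> Poly_Mapping.keys q" "m = a + b"
      using m Poly_Mapping.keys_mult[of p q] by blast
    then show ?thesis
      using assms Poly_Mapping.keys_add[of a b] unfolding mpoly_vars_def by blast
  qed
  then show "mpoly_vars (p * q) \<subseteq> I" unfolding mpoly_vars_def by blast
qed

text \<open>
  The polynomials over \<open>\<rat>\<close>, evaluated at the dual numbers \<open>\<alpha> i + c i \<epsilon>\<close>, form the graph of a
  derivation on \<open>\<rat>[\<alpha>]\<close>: a polynomial whose value has real part zero is the zero polynomial, by algebraic
  independence.
\<close>

theorem algebraically_independent_derivation: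
  assumes ind: "algebraically_independent I \<alpha>"
  shows "\<exists>\<delta>. derivation \<delta> \<and> (\<forall>i\<in>I. \<delta> (\<alpha> i) = c i)"
proof -
  define \<iota> :: "rat \<Rightarrow> complex dual" where "\<iota> = (\<lambda>q. Dual (of_rat q) 0)"
  define x where "x = (\<lambda>i. Dual (\<alpha> i) (c i))"
  define S where "S = {mpoly_at \<iota> x p | p. mpoly_vars p \<subseteq> I}"
  have hom: "\<iota> 1 = 1" "\<And>a b. \<iota> (a + b) = \<iota> a + \<iota> b" "\<And>a b. \<iota> (a * b) = \<iota> a * \<iota> b"
    by (auto simp: \<iota>_def dual_eq_iff of_rat_add of_rat_mult)
  have re: "re_part (mpoly_at \<iota> x p) = mpoly_eval p \<alpha>" for p
    by (simp add: mpoly_at_def mpoly_eval_def monomial_at_def re_part_sum re_part_prod \<iota>_def x_def)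
  have diff: "mpoly_at \<iota> x (p - q) = mpoly_at \<iota> x p - mpoly_at \<iota> x q" for p q
    using mpoly_at_add[of \<iota> x "p - q" q, OF hom] by (simp add: algebra_simps)
  have one: "mpoly_at \<iota> x 1 = 1"
    using mpoly_at_single[of \<iota> x 0 1, OF hom] by (simp add: hom monomial_at_def)
  have "subring_of S"
    unfolding subring_of_def
  proof (intro conjI ballI)
    show "1 \<in> S" unfolding S_def using one by (auto intro!: exI[of _ 1] simp: mpoly_vars_def)
    fix u v assume "u \<in> S" "v \<in> S"
    then obtain p q where "u = mpoly_at \<iota> x p" "v = mpoly_at \<iota> x q"
      "mpoly_vars p \<subseteq> I" "mpoly_vars q \<subseteq> I" by (auto simp: S_def)
    then show "u - v \<in> S" "u * v \<in> S"
      using mpoly_vars_ring_ops[of p I q] diff mpoly_at_mult[of \<iota> x p q, OF hom]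
      unfolding S_def by (force intro: exI[of _ "p - q"], force intro: exI[of _ "p * q"])
  qed
  moreover have "s = 0" if s: "s \<in> S" "re_part s = 0" for s
  proof -
    obtain p where p: "s = mpoly_at \<iota> x p" "mpoly_vars p \<subseteq> I" using s(1) by (auto simp: S_def)
    then have "p = 0"
      using ind s(2) re[of p] unfolding algebraically_independent_def mpoly_vars_def by (simp add: UN_subset_iff)
    then show ?thesis using p mpoly_at_0[of \<iota> x, OF hom] by simp
  qed
  ultimately have "partial_derivation S" by (auto simp: partial_derivation_def)
  then obtain \<delta> where \<delta>: "derivation \<delta>" "\<And>s. s \<in> S \<Longrightarrow> \<delta> (re_part s) = eps_part s"
    using derivation_extends by blast
  have "\<delta> (\<alpha> i) = c i" if "i \<in> I" for i
  proof -
    let ?m = "Poly_Mapping.single i (1::nat)"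
    have "mpoly_at \<iota> x (Poly_Mapping.single ?m 1) = x i"
      using mpoly_at_single[of \<iota> x ?m 1, OF hom] by (simp add: hom monomial_at_def)
    moreover have "mpoly_vars (Poly_Mapping.single ?m (1::rat)) \<subseteq> I" using that by (simp add: mpoly_vars_def)
    ultimately have "x i \<in> S" unfolding S_def by (metis (mono_tags, lifting) mem_Collect_eq)
    then show ?thesis using \<delta>(2)[of "x i"] by (simp add: x_def)
  qed
  then show ?thesis using \<delta>(1) by blast
qed

section \<open>The polynomial Pell equation over a generic base\<close>

text \<open>
  Gaussian elimination: if some vector has a nonzero last coordinate, it serves to clear that
  coordinate in all the others.
\<close>

lemma exists_linear_relation:
  fixes v :: "'i \<Rightarrow> nat \<Rightarrow> 'a::field"
  assumes "finite I" "k < card I"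
  shows "\<exists>c. (\<exists>i\<in>I. c i \<noteq> 0) \<and> (\<forall>j<k. (\<Sum>i\<in>I. c i * v i j) = 0)"
  using assms
proof (induction k arbitrary: I v)
  case 0
  then have "I \<noteq> {}" by auto
  then show ?case by (intro exI[of _ "\<lambda>_. 1"]) auto
next
  case (Suc k)
  show ?case
  proof (cases "\<exists>i\<in>I. v i k \<noteq> 0")
    case False
    then show ?thesis
      using Suc.IH[of I v] Suc.prems by (auto simp: less_Suc_eq)
  next
    case True
    then obtain l where l: "l \<in> I" "v l k \<noteq> 0" by blast
    define w where "w = (\<lambda>i j. v i j - v i k / v l k * v l j)"
    have "k < card (I - {l})" using Suc.prems l by simp
    then obtain c where c: "\<exists>i\<in>I - {l}. c i \<noteq> 0" "\<And>j. j < k \<Longrightarrow> (\<Sum>i\<in>I - {l}. c i * w i j) = 0"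
      using Suc.IH[of "I - {l}" w] Suc.prems by auto
    \<comment> \<open>the coefficient at \<open>l\<close> undoes the elimination step\<close>
    define c' where "c' = c(l := - (\<Sum>i\<in>I - {l}. c i * (v i k / v l k)))"
    have eq: "(\<Sum>i\<in>I. c' i * v i j) = (\<Sum>i\<in>I - {l}. c i * w i j)" for j
    proof -
      have "(\<Sum>i\<in>I. c' i * v i j) = c' l * v l j + (\<Sum>i\<in>I - {l}. c i * v i j)"
        using Suc.prems(1) l(1) by (subst sum.remove[of _ l]) (auto simp: c'_def intro: sum.cong)
      then show ?thesis
        by (simp add: c'_def w_def algebra_simps sum_subtractf sum_distrib_left)
    qed
    have "(\<Sum>i\<in>I. c' i * v i j) = 0" if "j < Suc k" for j
    proof (cases "j = k")
      case True
      then show ?thesis using l(2) by (simp add: eq w_def)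
    next
      case False
      then show ?thesis using that c(2)[of j] by (simp add: eq)
    qed
    moreover have "\<exists>i\<in>I. c' i \<noteq> 0" using c(1) by (auto simp: c'_def)
    ultimately show ?thesis by blast
  qed
qed

lemma exists_linear_relation_poly:
  fixes V :: "'i \<Rightarrow> 'a::field poly"
  assumes "finite I" "k < card I" "\<And>i n. i \<in> I \<Longrightarrow> n \<ge> k \<Longrightarrow> coeff (V i) n = 0"
  shows "\<exists>c. (\<exists>i\<in>I. c i \<noteq> 0) \<and> (\<Sum>i\<in>I. smult (c i) (V i)) = 0"
proof -
  obtain c where c: "\<exists>i\<in>I. c i \<noteq> 0" "\<And>j. j < k \<Longrightarrow> (\<Sum>i\<in>I. c i * coeff (V i) j) = 0"
    using exists_linear_relation[OF assms(1,2), of "\<lambda>i. coeff (V i)"] by blast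
  have "coeff (\<Sum>i\<in>I. smult (c i) (V i)) n = 0" for n
    using c(2)[of n] assms(3)[of _ n] by (cases "n < k") (auto simp: coeff_sum)
  then show ?thesis using c(1) by (metis leading_coeff_0_iff)
qed

lemma dvd_if_order_le:
  fixes p q :: "complex poly"
  assumes "p \<noteq> 0" "q \<noteq> 0" "\<And>a. order a p \<le> order a q"
  shows "p dvd q"
  using assms
proof (induction "degree p" arbitrary: p q)
  case 0
  then show ?case by (simp add: is_unit_iff_degree unit_imp_dvd)
next
  case (Suc n)
  then obtain a where a: "poly p a = 0"
    using fundamental_theorem_of_algebra_alt[of p] by (metis degree_pCons_0 nat.distinct(1))
  then obtain p' where p': "p = [:- a, 1:] * p'" by (metis dvdE poly_eq_0_iff_dvd)
  have "poly q a = 0"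
    using Suc.prems(1) Suc.prems(3)[of a] a by (metis le_zero_eq order_root)
  then obtain q' where q': "q = [:- a, 1:] * q'" by (metis dvdE poly_eq_0_iff_dvd)
  have nz: "p' \<noteq> 0" "q' \<noteq> 0" using Suc.prems p' q' by auto
  have "order b p' \<le> order b q'" for b
    using Suc.prems(3)[of b] order_mult[of "[:- a, 1:]" p' b] order_mult[of "[:- a, 1:]" q' b] p' q' Suc.prems
    by simp
  moreover have "n = degree p'"
    using Suc.hyps(2) nz by (simp add: p' degree_mult_eq del: mult_pCons_left)
  ultimately have "p' dvd q'" using Suc.hyps(1) nz by blast
  then show ?case unfolding p' q' by (rule mult_dvd_mono[OF dvd_refl])
qed

text \<open>
  Over \<open>\<complex>\<close>, an \<open>N\<close>-th root is obtained by dividing all multiplicities by \<open>N\<close> and taking an \<open>N\<close>-th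
  root of the leading coefficient.
\<close>

lemma is_power_if_orders_divisible:
  fixes p :: "complex poly"
  assumes "p \<noteq> 0" "N > 0" "\<And>a. N dvd order a p"
  shows "\<exists>U. p = U ^ N"
proof -
  obtain c where c: "c ^ N = lead_coeff p"
    using \<open>N > 0\<close> by (metis One_nat_def Suc_leI nth_root_exists)
  let ?U = "smult c (\<Prod>z|poly p z = 0. [:- z, 1:] ^ (order z p div N))"
  have "?U ^ N = smult (lead_coeff p) (\<Prod>z|poly p z = 0. [:- z, 1:] ^ order z p)"
    using assms(3) by (simp add: smult_power c prod_power_distrib power_mult[symmetric])
  then show ?thesis using complex_poly_decompose[of p] by metis
qed

lemma derivationD:
  assumes "derivation \<delta>"
  shows "\<delta> (x + y) = \<delta> x + \<delta> y" "\<delta> (x * y) = \<delta> x * y + x * \<delta> y" "\<delta> 0 = 0" "\<delta> 1 = 0"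
    "\<delta> (- x) = - \<delta> x" "\<delta> (sum h A) = (\<Sum>i\<in>A. \<delta> (h i))"
proof -
  show 1: "\<delta> (x + y) = \<delta> x + \<delta> y" "\<delta> (x * y) = \<delta> x * y + x * \<delta> y" for x y
    using assms by (auto simp: derivation_def)
  show 0: "\<delta> 0 = 0" using 1(1)[of 0 0] by simp
  show "\<delta> 1 = 0" using 1(2)[of 1 1] by simp
  show "\<delta> (- x) = - \<delta> x" using 1(1)[of x "- x"] 0 by (simp add: eq_neg_iff_add_eq_0 add.commute)
  show "\<delta> (sum h A) = (\<Sum>i\<in>A. \<delta> (h i))"
    by (induction A rule: infinite_finite_induct) (auto simp: 0 1)
qed

lemma map_poly_derivation:
  assumes "derivation \<delta>"
  shows "derivation (map_poly \<delta>)"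
  unfolding derivation_def
proof (intro conjI allI poly_eqI)
  note [simp] = derivationD[OF assms] coeff_map_poly
  fix p q :: "'a poly" and n
  show "coeff (map_poly \<delta> (p + q)) n = coeff (map_poly \<delta> p + map_poly \<delta> q) n" by simp
  show "coeff (map_poly \<delta> (p * q)) n = coeff (map_poly \<delta> p * q + p * map_poly \<delta> q) n"
    by (simp add: coeff_mult sum.distrib)
qed

lemma map_poly_derivation_linear:
  assumes "derivation \<delta>"
  shows "map_poly \<delta> [:- a, 1:] = [:- \<delta> a:]"
  by (simp add: map_poly_pCons derivationD[OF assms])

lemma derivation_power:
  fixes \<delta> :: "'a::comm_ring_1 \<Rightarrow> 'a"
  assumes "derivation \<delta>"
  shows "\<delta> (x ^ Suc n) = of_nat (Suc n) * x ^ n * \<delta> x"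
  by (induction n) (auto simp: derivationD[OF assms] algebra_simps)

lemma derivation_sum:
  fixes \<delta> :: "'i \<Rightarrow> 'a::comm_ring_1 \<Rightarrow> 'a"
  assumes "\<And>i. i \<in> I \<Longrightarrow> derivation (\<delta> i)"
  shows "derivation (\<lambda>x. \<Sum>i\<in>I. c i * \<delta> i x)"
  unfolding derivation_def
proof (intro conjI allI)
  fix x y
  show "(\<Sum>i\<in>I. c i * \<delta> i (x + y)) = (\<Sum>i\<in>I. c i * \<delta> i x) + (\<Sum>i\<in>I. c i * \<delta> i y)"
    using derivationD(1)[OF assms] by (simp add: algebra_simps sum.distrib)
  have "c i * \<delta> i (x * y) = c i * \<delta> i x * y + x * (c i * \<delta> i y)" if "i \<in> I" for i
    using derivationD(2)[OF assms[OF that]] by (simp add: algebra_simps)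
  then show "(\<Sum>i\<in>I. c i * \<delta> i (x * y)) = (\<Sum>i\<in>I. c i * \<delta> i x) * y + x * (\<Sum>i\<in>I. c i * \<delta> i y)"
    by (simp add: sum.distrib sum_distrib_left sum_distrib_right)
qed

text \<open>
  Extend \<open>\<delta>\<close> to the functions of \<open>x\<close> and \<open>y\<close>, with \<open>y\<^sup>2 = f\<close>, by \<open>\<delta> x = 0\<close>; then
  \<open>\<delta> y = (\<delta> f) y / (2 f)\<close>.  The logarithmic derivative of \<open>(A + B y) / (A - B y)\<close> is \<open>y\<close> times the
  following polynomial divided by \<open>f (A\<^sup>2 - f B\<^sup>2)\<close>.
\<close>

definition log_deriv_numerator ::
    "'a::comm_ring_1 poly \<Rightarrow> 'a poly \<Rightarrow> 'a poly \<Rightarrow> ('a \<Rightarrow> 'a) \<Rightarrow> 'a poly" where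
  "log_deriv_numerator f A B \<delta> =
     2 * f * (map_poly \<delta> B * A - map_poly \<delta> A * B) + A * B * map_poly \<delta> f"

lemma log_deriv_numerator_sum:
  fixes \<delta> :: "'i \<Rightarrow> 'a::comm_ring_1 \<Rightarrow> 'a"
  assumes "finite I" "\<And>i. i \<in> I \<Longrightarrow> derivation (\<delta> i)"
  shows "log_deriv_numerator f A B (\<lambda>x. \<Sum>i\<in>I. c i * \<delta> i x)
    = (\<Sum>i\<in>I. smult (c i) (log_deriv_numerator f A B (\<delta> i)))"
proof -
  have m: "map_poly (\<lambda>x. \<Sum>i\<in>I. c i * \<delta> i x) p = (\<Sum>i\<in>I. smult (c i) (map_poly (\<delta> i) p))" for p
  proof (rule poly_eqI)
    fix n
    have 0: "i \<in> I \<Longrightarrow> \<delta> i 0 = 0" for i using derivationD(3) assms by blast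
    then have "(\<Sum>i\<in>I. c i * \<delta> i 0) = 0" by simp
    then show "coeff (map_poly (\<lambda>x. \<Sum>i\<in>I. c i * \<delta> i x) p) n = coeff (\<Sum>i\<in>I. smult (c i) (map_poly (\<delta> i) p)) n"
      using 0 by (simp add: coeff_map_poly coeff_sum)
  qed
  have "(\<Sum>i\<in>I. smult (c i) (log_deriv_numerator f A B (\<delta> i)))
      = (\<Sum>i\<in>I. 2 * f * (smult (c i) (map_poly (\<delta> i) B) * A - smult (c i) (map_poly (\<delta> i) A) * B)
          + A * B * smult (c i) (map_poly (\<delta> i) f))"
    by (intro sum.cong refl) (simp add: log_deriv_numerator_def smult_add_right flip: smult_diff_right)
  also have "\<dots> = log_deriv_numerator f A B (\<lambda>x. \<Sum>i\<in>I. c i * \<delta> i x)"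
    unfolding log_deriv_numerator_def m sum.distrib sum_subtractf
      sum_distrib_left[symmetric] sum_distrib_right[symmetric] ..
  finally show ?thesis ..
qed

text \<open>
  After multiplication by \<open>b\<close>, the derivatives \<open>f'\<close> and \<open>b'\<close> occur only in the combination that the
  differentiated Pell equation, the first hypothesis, expresses by \<open>a'\<close>; after multiplication by \<open>a\<close>, it is
  \<open>a'\<close> that can be eliminated.
\<close>

lemma log_deriv_identities:
  fixes a b f a' b' f' :: "'a::idom"
  assumes "2 * a * a' - (f' * b ^ 2 + 2 * f * b * b') = u * e" and "a ^ 2 - f * b ^ 2 = u * v"
  shows "(2 * f * (b' * a - a' * b) + a * b * f') * b = u * (2 * a' * v - a * e)"
    and "(2 * f * (b' * a - a' * b) + a * b * f') * a = u * (v * (2 * f * b' + b * f') - f * b * e)"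
proof -
  have "(2 * f * (b' * a - a' * b) + a * b * f') * b
      = 2 * a' * (a ^ 2 - f * b ^ 2) - a * (2 * a * a' - (f' * b ^ 2 + 2 * f * b * b'))"
    by (simp add: algebra_simps power2_eq_square)
  then show "(2 * f * (b' * a - a' * b) + a * b * f') * b = u * (2 * a' * v - a * e)"
    unfolding assms by (simp add: algebra_simps)
  have "(2 * f * (b' * a - a' * b) + a * b * f') * a
      = (a ^ 2 - f * b ^ 2) * (2 * f * b' + b * f') - f * b * (2 * a * a' - (f' * b ^ 2 + 2 * f * b * b'))"
    by (simp add: algebra_simps power2_eq_square)
  then show "(2 * f * (b' * a - a' * b) + a * b * f') * a = u * (v * (2 * f * b' + b * f') - f * b * e)"
    unfolding assms by (simp add: algebra_simps)
qed

text \<open>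
  A logarithmic derivative has at most simple poles.  In terms of polynomials: differentiating the
  Pell equation shows that \<open>U ^ n\<close> divides the products of the numerator with \<open>A\<close> and with \<open>B\<close>, and
  at each point one of \<open>A\<close>, \<open>B\<close> does not vanish.
\<close>

lemma power_dvd_log_deriv_numerator:
  fixes f A B U :: "complex poly"
  assumes d: "derivation \<delta>" and pell: "A ^ 2 - f * B ^ 2 = U ^ Suc n"
    and nocommon: "\<And>a. \<not> (poly A a = 0 \<and> poly B a = 0)" and "U \<noteq> 0"
  shows "U ^ n dvd log_deriv_numerator f A B \<delta>"
proof (cases "log_deriv_numerator f A B \<delta> = 0")
  case False
  define W where "W = log_deriv_numerator f A B \<delta>"
  let ?D = "map_poly \<delta>"
  define E where "E = of_nat (Suc n) * ?D U"
  note D = derivationD[OF map_poly_derivation[OF d]]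
  have "?D (A * A + - (f * (B * B))) = 2 * A * ?D A - (?D f * B ^ 2 + 2 * f * B * ?D B)"
    unfolding D(1,2,5) by (simp only: mult_2 power2_eq_square ring_distribs mult_ac add_ac minus_add_distrib diff_conv_add_uminus)
  then have "?D (A ^ 2 - f * B ^ 2) = 2 * A * ?D A - (?D f * B ^ 2 + 2 * f * B * ?D B)"
    by (simp add: power2_eq_square)
  then have diff: "2 * A * ?D A - (?D f * B ^ 2 + 2 * f * B * ?D B) = U ^ n * E"
    unfolding pell derivation_power[OF map_poly_derivation[OF d]] E_def by (simp only: mult_ac)
  have pell': "A ^ 2 - f * B ^ 2 = U ^ n * U" using pell by (simp only: power_Suc mult.commute)
  have "W * B = U ^ n * (2 * ?D A * U - A * E)"
    unfolding W_def log_deriv_numerator_def by (rule log_deriv_identities(1)[OF diff pell'])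
  then have WB: "U ^ n dvd W * B" by simp
  have "W * A = U ^ n * (U * (2 * f * ?D B + B * ?D f) - f * B * E)"
    unfolding W_def log_deriv_numerator_def by (rule log_deriv_identities(2)[OF diff pell'])
  then have WA: "U ^ n dvd W * A" by simp
  have "order a (U ^ n) \<le> order a W" for a
  proof -
    have W: "W \<noteq> 0" using False by (simp add: W_def)
    obtain C where C: "U ^ n dvd W * C" "poly C a \<noteq> 0" using WA WB nocommon by blast
    then have "C \<noteq> 0" by auto
    have "order a (U ^ n) \<le> order a (W * C)"
      using C W \<open>C \<noteq> 0\<close> by (intro dvd_imp_order_le) auto
    also have "\<dots> = order a W" using C(2) W \<open>C \<noteq> 0\<close> by (simp add: order_mult order_0I)
    finally show ?thesis .
  qed
  then show ?thesis
    using dvd_if_order_le[of "U ^ n" W] False \<open>U \<noteq> 0\<close> by (simp add: W_def)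
qed simp

text \<open>
  The factorization used below, with \<open>l = x - a\<close>, \<open>c = \<delta> l\<close>, \<open>p = l ^ r\<close> and \<open>B = p b\<close>; the
  hypothesis is the power rule \<open>l \<delta>(l ^ r) = r l ^ r \<delta> l\<close>, multiplied by \<open>l\<close> in order to be valid
  for \<open>r = 0\<close>.
\<close>

lemma log_deriv_leading_term:
  fixes a a' b b' c f1 f1' l p p' r :: "'a::idom"
  assumes "l * p' = r * p * c"
  shows "2 * (l * f1) * ((p' * b + p * b') * a - a' * (p * b)) + a * (p * b) * (c * f1 + l * f1')
    = p * (2 * a * (f1 * l * b' + r * c * f1 * b) - 2 * l * f1 * a' * b + a * b * (c * f1 + l * f1'))"
proof -
  have "l * (p' * x) = r * (p * (c * x))" for x
    using assms by (simp flip: mult.assoc)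
  then show ?thesis by (simp add: algebra_simps)
qed

text \<open>
  If \<open>\<delta>\<close> moves a simple root \<open>a\<close> of \<open>f\<close>, then \<open>\<delta>\<close> lowers positive orders of vanishing at \<open>a\<close> by one.
  Write \<open>B = (x - a) ^ r B\<^sub>1\<close> with \<open>r = order a B\<close>, and \<open>f = (x - a) f\<^sub>1\<close>.
  The coefficient of \<open>(x - a) ^ r\<close> in the numerator gets \<open>2 r\<close> times
  \<open>- \<delta> a A(a) B\<^sub>1(a) f\<^sub>1(a)\<close> from \<open>B\<close> and once the same from \<open>f\<close>, and \<open>2 r + 1 \<noteq> 0\<close>.
\<close>

lemma log_deriv_numerator_nonzero:
  fixes f f1 A B :: "complex poly"
  assumes d: "derivation \<delta>" and f: "f = [:- a, 1:] * f1"
    and nz: "poly f1 a \<noteq> 0" "poly A a \<noteq> 0" "B \<noteq> 0" "\<delta> a \<noteq> 0"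
  shows "log_deriv_numerator f A B \<delta> \<noteq> 0"
proof
  assume W0: "log_deriv_numerator f A B \<delta> = 0"
  let ?D = "map_poly \<delta>" and ?L = "[:- a, 1:]"
  define r where "r = order a B"
  obtain B1 where B1: "B = ?L ^ r * B1" "\<not> ?L dvd B1"
    using order_decomp[OF nz(3)] r_def by blast
  define c where "c = [:- \<delta> a:]"
  note D = derivationD[OF map_poly_derivation[OF d]]
  have DL: "?D ?L = c" using map_poly_derivation_linear[OF d] by (simp add: c_def)
  have Df: "?D f = c * f1 + ?L * ?D f1" unfolding f D(2) DL ..
  have LDLr: "?L * ?D (?L ^ r) = of_nat r * ?L ^ r * c"
  proof (cases r)
    case 0
    then show ?thesis using D(4) by simp
  next
    case (Suc k)
    show ?thesis
      unfolding Suc derivation_power[OF map_poly_derivation[OF d]] DL by (simp only: power_Suc mult_ac)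
  qed
  define M where "M = ?L"
  define T where "T = 2 * A * (f1 * M * ?D B1 + of_nat r * c * f1 * B1)
      - 2 * M * f1 * ?D A * B1 + A * B1 * (c * f1 + M * ?D f1)"
  have "log_deriv_numerator f A B \<delta> = ?L ^ r * T"
    unfolding log_deriv_numerator_def Df T_def B1(1) D(2) M_def[symmetric]
    unfolding f M_def[symmetric] by (rule log_deriv_leading_term) (use LDLr in \<open>simp only: M_def\<close>)
  then have "T = 0" using W0 by simp
  have "poly T a = - (poly A a * poly B1 a * poly f1 a * \<delta> a * (2 * of_nat r + 1))"
    by (simp add: T_def M_def c_def algebra_simps)
  with \<open>T = 0\<close> have "poly A a * poly B1 a * poly f1 a * \<delta> a * (2 * of_nat r + 1) = 0" by simp
  moreover have "poly B1 a \<noteq> 0" using B1(2) by (simp add: poly_eq_0_iff_dvd)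
  moreover have "2 * of_nat r + 1 \<noteq> (0::complex)"
    using of_nat_neq_0[of "2 * r", where 'a = complex] by (simp add: add.commute)
  ultimately show False using nz by simp
qed

text \<open>
  A parity argument: \<open>f B\<^sup>2\<close> has odd degree whereas \<open>A\<^sup>2\<close> and \<open>U ^ N\<close> have even degree, so \<open>A\<^sup>2\<close> dominates.
\<close>

lemma pell_degrees:
  fixes f A B U :: "complex poly"
  assumes f: "degree f = 2 * g + 1" and pell: "A ^ 2 - f * B ^ 2 = U ^ N"
    and N: "even N" and B: "B \<noteq> 0"
  shows "U \<noteq> 0 \<or> N = 0" "2 * degree A = N * degree U" "degree B + g + 1 \<le> degree A"
proof -
  have "f \<noteq> 0" using f by auto
  then have dfB: "degree (f * B ^ 2) = 2 * g + 1 + 2 * degree B"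
    using B f by (simp add: degree_mult_eq degree_power_eq)
  have dA: "degree (A ^ 2) = 2 * degree A" by (cases "A = 0") (simp_all add: degree_power_eq)
  have dU: "degree (U ^ N) = N * degree U" by (cases "U = 0") (simp_all add: degree_power_eq power_0_left)
  have "degree (f * B ^ 2) < degree (A ^ 2)"
  proof (rule ccontr)
    assume "\<not> ?thesis"
    moreover have "degree (A ^ 2) \<noteq> degree (f * B ^ 2)" unfolding dA dfB by presburger
    ultimately have "degree (A ^ 2 - f * B ^ 2) = degree (f * B ^ 2)"
      using degree_add_eq_right[of "A ^ 2" "- (f * B ^ 2)"] by simp
    then have "N * degree U = 2 * g + 1 + 2 * degree B" using pell dU dfB by simp
    moreover have "even (N * degree U)" using N by simp
    ultimately show False by presburger
  qed
  then have "degree (A ^ 2 - f * B ^ 2) = degree (A ^ 2)"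
    using degree_add_eq_left[of "- (f * B ^ 2)" "A ^ 2"] by simp
  then show eq: "2 * degree A = N * degree U" using pell dU dA by simp
  show "degree B + g + 1 \<le> degree A"
    using \<open>degree (f * B ^ 2) < degree (A ^ 2)\<close> unfolding dfB dA by linarith
  then show "U \<noteq> 0 \<or> N = 0" using eq by auto
qed

lemma degree_log_deriv_numerator_le:
  fixes f A B :: "complex poly"
  shows "degree (log_deriv_numerator f A B \<delta>) \<le> degree f + degree A + degree B"
proof -
  have D: "degree (map_poly \<delta> p) \<le> degree p" for p by (rule map_poly_degree_leq)
  have "degree (map_poly \<delta> B * A - map_poly \<delta> A * B) \<le> degree A + degree B"
    using D[of A] D[of B] degree_mult_le[of "map_poly \<delta> B" A] degree_mult_le[of "map_poly \<delta> A" B]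
    by (intro degree_diff_le) linarith+
  then have 1: "degree (2 * f * (map_poly \<delta> B * A - map_poly \<delta> A * B)) \<le> degree f + degree A + degree B"
    using degree_mult_le[of "2 * f" "map_poly \<delta> B * A - map_poly \<delta> A * B"] degree_mult_le[of 2 f]
    by simp
  have "degree (A * B * map_poly \<delta> f) \<le> degree f + degree A + degree B"
    using degree_mult_le[of "A * B" "map_poly \<delta> f"] degree_mult_le[of A B] D[of f] by simp
  with 1 show ?thesis unfolding log_deriv_numerator_def by (intro degree_add_le)
qed

text \<open>
  A derivation with values \<open>1\<close> and \<open>0\<close> at two of the elements tells them apart.
\<close>

lemma algebraically_independent_inj_on:
  assumes "algebraically_independent I \<alpha>"
  shows "inj_on \<alpha> I"
proof (rule inj_onI, rule ccontr)
  fix i j assume ij: "i \<in> I" "j \<in> I" "\<alpha> i = \<alpha> j" "i \<noteq> j"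
  obtain \<delta> :: "complex \<Rightarrow> complex" where "\<forall>k\<in>I. \<delta> (\<alpha> k) = (if k = i then 1 else 0)"
    using algebraically_independent_derivation[OF assms, of "\<lambda>k. if k = i then 1 else 0"] by blast
  from this[rule_format, of i] this[rule_format, of j] ij show False by simp
qed

text \<open>
  The parameter count described at the beginning.  The bound \<open>degree U < g\<close> is what makes the \<open>2 g + 1\<close>
  quotients \<open>V i\<close> linearly dependent.
\<close>

theorem generic_pell_equation:
  fixes \<alpha> :: "nat \<Rightarrow> complex" and f A B U :: "complex poly"
  assumes ind: "algebraically_independent {1..2 * g + 1} \<alpha>"
    and f: "f = (\<Prod>i\<in>{1..2 * g + 1}. [:- \<alpha> i, 1:])"
    and pell: "A ^ 2 - f * B ^ 2 = U ^ N" and N: "even N" "N > 0"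
    and nocommon: "\<And>a. \<not> (poly A a = 0 \<and> poly B a = 0)" and deg: "degree U < g"
  shows "B = 0"
proof (rule ccontr)
  assume B: "B \<noteq> 0"
  define I where "I = {1..2 * g + 1}"
  have "finite I" by (simp add: I_def)
  have inj: "inj_on \<alpha> {1..2 * g + 1}" by (rule algebraically_independent_inj_on[OF ind])
  have "degree f = 2 * g + 1" unfolding f by (subst degree_prod_sum_eq) auto
  note degs = pell_degrees[OF this pell N(1) B]
  have "U \<noteq> 0" using degs N by simp
  obtain n where n: "N = Suc n" using N by (cases N) auto
  have "\<exists>\<delta>. derivation \<delta> \<and> (\<forall>j\<in>I. \<delta> (\<alpha> j) = (if j = i then 1 else 0))" for i
    unfolding I_def by (rule algebraically_independent_derivation[OF ind])
  then obtain \<delta> where \<delta>: "\<And>i. derivation (\<delta> i)"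
    "\<And>i j. j \<in> I \<Longrightarrow> \<delta> i (\<alpha> j) = (if j = i then 1 else 0)"
    by metis
  define W where "W = (\<lambda>i. log_deriv_numerator f A B (\<delta> i))"
  have "\<exists>V. W i = U ^ n * V" for i
    using power_dvd_log_deriv_numerator[OF \<delta>(1) pell[unfolded n] nocommon \<open>U \<noteq> 0\<close>]
    by (simp add: W_def dvd_def)
  then obtain V where V: "\<And>i. W i = U ^ n * V i" by metis
  have "coeff (V i) m = 0" if "m \<ge> 2 * g" for i m
  proof (cases "V i = 0")
    case False
    have "n * degree U + degree (V i) = degree (W i)"
      using False \<open>U \<noteq> 0\<close> by (simp add: V degree_mult_eq degree_power_eq)
    also have "\<dots> \<le> 2 * g + 1 + degree A + degree B"
      using degree_log_deriv_numerator_le[of f A B "\<delta> i"] \<open>degree f = 2 * g + 1\<close> by (simp add: W_def)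
    also have "\<dots> \<le> n * degree U + degree U + g"
      using degs(2,3) by (simp add: n)
    finally have "degree (V i) < 2 * g" using deg by linarith
    then show ?thesis using that by (intro coeff_eq_0) linarith
  qed simp
  then obtain c where c: "\<exists>i\<in>I. c i \<noteq> 0" "(\<Sum>i\<in>I. smult (c i) (V i)) = 0"
    using exists_linear_relation_poly[OF \<open>finite I\<close>, of "2 * g" V] by (auto simp: I_def)
  define \<Delta> where "\<Delta> = (\<lambda>x. \<Sum>i\<in>I. c i * \<delta> i x)"
  have \<Delta>: "derivation \<Delta>" unfolding \<Delta>_def by (rule derivation_sum) (rule \<delta>(1))
  have "log_deriv_numerator f A B \<Delta> = (\<Sum>i\<in>I. smult (c i) (U ^ n * V i))"
    unfolding \<Delta>_def log_deriv_numerator_sum[OF \<open>finite I\<close> \<delta>(1)] V[unfolded W_def] ..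
  also have "\<dots> = U ^ n * (\<Sum>i\<in>I. smult (c i) (V i))" by (simp add: sum_distrib_left)
  finally have W0: "log_deriv_numerator f A B \<Delta> = 0" by (simp add: c)
  obtain k where k: "k \<in> I" "c k \<noteq> 0" using c by blast
  have "\<Delta> (\<alpha> k) = c k"
    using k \<open>finite I\<close> by (simp add: \<Delta>_def \<delta>(2) if_distrib cong: if_cong)
  define f1 where "f1 = (\<Prod>i\<in>I - {k}. [:- \<alpha> i, 1:])"
  have f1: "f = [:- \<alpha> k, 1:] * f1"
    using k \<open>finite I\<close> unfolding f f1_def I_def[symmetric] by (intro prod.remove)
  have f1k: "poly f1 (\<alpha> k) \<noteq> 0"
    using k inj \<open>finite I\<close> unfolding I_def[symmetric] by (auto simp: f1_def poly_prod inj_on_def)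
  \<comment> \<open>otherwise \<open>\<alpha> k\<close> is a multiple root of \<open>A\<^sup>2\<close> and of \<open>U ^ N\<close>, and as \<open>f\<close> has a simple root there, \<open>B\<close> vanishes as well\<close>
  have "poly A (\<alpha> k) \<noteq> 0"
  proof
    assume A0: "poly A (\<alpha> k) = 0"
    then have "poly (U ^ N) (\<alpha> k) = 0" unfolding pell[symmetric] by (simp add: f1)
    then have "[:- \<alpha> k, 1:] dvd U" using poly_eq_0_iff_dvd by (metis poly_power power_eq_0_iff)
    moreover have "2 \<le> N" using N by presburger
    ultimately have "[:- \<alpha> k, 1:] ^ 2 dvd U ^ N"
      by (meson dvd_power_same dvd_trans le_imp_power_dvd)
    moreover have "[:- \<alpha> k, 1:] ^ 2 dvd A ^ 2" using A0 by (metis dvd_power_same poly_eq_0_iff_dvd)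
    ultimately have "[:- \<alpha> k, 1:] ^ 2 dvd A ^ 2 - U ^ N" by (rule dvd_diff[rotated])
    then have "[:- \<alpha> k, 1:] ^ 2 dvd f * B ^ 2" unfolding pell[symmetric] by simp
    then have "[:- \<alpha> k, 1:] dvd f1 * B ^ 2"
      unfolding f1 power2_eq_square mult.assoc by (subst (asm) dvd_mult_cancel_left) simp
    then have "poly B (\<alpha> k) = 0" using f1k by (simp add: poly_eq_0_iff_dvd[symmetric])
    then show False using nocommon A0 by blast
  qed
  then show False
    using log_deriv_numerator_nonzero[OF \<Delta> f1 f1k _ B] W0 \<open>\<Delta> (\<alpha> k) = c k\<close> k by simp
qed

section \<open>Orders of vanishing in a chart of a plane curve\<close>

lemma factor_common_roots:
  fixes p q :: "complex poly"
  assumes "p \<noteq> 0 \<or> q \<noteq> 0"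
  shows "\<exists>h A B. h \<noteq> 0 \<and> p = h * A \<and> q = h * B \<and> (\<forall>a. \<not> (poly A a = 0 \<and> poly B a = 0))"
  using assms
proof (induction "degree p + degree q" arbitrary: p q rule: less_induct)
  case less
  show ?case
  proof (cases "\<exists>a. poly p a = 0 \<and> poly q a = 0")
    case False
    then show ?thesis by (intro exI[of _ 1] exI[of _ p] exI[of _ q]) auto
  next
    case True
    then obtain a p1 q1 where pq: "p = [:- a, 1:] * p1" "q = [:- a, 1:] * q1"
      by (metis dvdE poly_eq_0_iff_dvd)
    have deg: "degree r \<le> degree ([:- a, 1:] * r) \<and> (r \<noteq> 0 \<longrightarrow> degree r < degree ([:- a, 1:] * r))" for r
      by (cases "r = 0") (simp_all add: degree_mult_eq del: mult_pCons_left)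
    have nz: "p1 \<noteq> 0 \<or> q1 \<noteq> 0" using less.prems pq by auto
    then have "degree p1 + degree q1 < degree p + degree q"
      using deg[of p1] deg[of q1] unfolding pq by linarith
    then obtain h A B where h: "h \<noteq> 0" "p1 = h * A" "q1 = h * B" "\<forall>a. \<not> (poly A a = 0 \<and> poly B a = 0)"
      using less.hyps nz by blast
    have "p = ([:- a, 1:] * h) * A" "q = ([:- a, 1:] * h) * B"
      unfolding pq h by (simp_all only: mult.assoc)
    moreover have "[:- a, 1:] * h \<noteq> 0" using h(1) by (metis mult_eq_0_iff one_neq_zero pCons_eq_0_iff)
    ultimately show ?thesis using h(4) by blast
  qed
qed

text \<open>
  A plane affine curve \<open>\<eta>\<^sup>2 = F(\<xi>)\<close> in terms of its functions: \<open>'k\<close> is a field that contains the function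
  field of the curve, \<open>c p\<close> is the function \<open>p(\<xi>)\<close>, and \<open>(a, b)\<close> is a smooth point of the curve.  The
  interpretations use \<open>\<xi> = x\<close> at affine points and \<open>\<xi> = 1 / x\<close> at infinity.
\<close>

locale curve_chart =
  fixes c :: "complex poly \<Rightarrow> 'k::field" and \<eta> :: 'k and F :: "complex poly" and a b :: complex
  assumes c_1: "c 1 = 1" and c_add: "c (p + q) = c p + c q" and c_mult: "c (p * q) = c p * c q"
    and indep: "c p + c q * \<eta> = 0 \<Longrightarrow> p = 0 \<and> q = 0"
    and eta: "\<eta> ^ 2 = c F" and on_curve: "b ^ 2 = poly F a"
    and smooth: "b = 0 \<Longrightarrow> \<exists>F1. F = [:- a, 1:] * F1 \<and> poly F1 a \<noteq> 0"
begin

lemma c_0 [simp]: "c 0 = 0"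
  using c_add[of 0 0] add_left_imp_eq[of "c 0" "c 0" 0] by simp

lemma c_minus: "c (- p) = - c p"
  using c_add[of p "- p"] by (simp add: eq_neg_iff_add_eq_0 add.commute)

lemma c_diff: "c (p - q) = c p - c q"
  using c_add[of p "- q"] c_minus by simp

lemma c_eq_0_iff [simp]: "c p = 0 \<longleftrightarrow> p = 0"
  using indep[of p 0] by auto

lemma c_power: "c (p ^ n) = c p ^ n"
  by (induction n) (auto simp: c_1 c_mult)

definition E :: "complex poly \<Rightarrow> complex poly \<Rightarrow> 'k" where "E p q = c p + c q * \<eta>"

definition val :: "complex poly \<Rightarrow> complex poly \<Rightarrow> complex" where
  "val p q = poly p a + poly q a * b"

definition loc_ring :: "'k set" where
  "loc_ring = {h. \<exists>p q p' q'. val p' q' \<noteq> 0 \<and> h * E p' q' = E p q}"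

definition loc_units :: "'k set" where
  "loc_units = {h. \<exists>p q p' q'. val p' q' \<noteq> 0 \<and> val p q \<noteq> 0 \<and> h * E p' q' = E p q}"

definition loc_max :: "'k set" where
  "loc_max = {h. \<exists>p q p' q'. val p' q' \<noteq> 0 \<and> val p q = 0 \<and> h * E p' q' = E p q}"

definition fun_field :: "'k set" where
  "fun_field = {h. \<exists>p q r. r \<noteq> 0 \<and> h * c r = E p q}"

lemma E_mult: "E p q * E p' q' = E (p * p' + F * q * q') (p * q' + q * p')"
proof -
  have "E p q * E p' q' = c p * c p' + c q * c q' * \<eta> ^ 2 + (c p * c q' + c q * c p') * \<eta>"
    by (simp add: E_def algebra_simps power2_eq_square)
  then show ?thesis by (simp add: E_def eta c_add c_mult algebra_simps)
qed

lemma val_mult: "val (p * p' + F * q * q') (p * q' + q * p') = val p q * val p' q'"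
proof -
  have "poly F a = b * b" using on_curve by (simp add: power2_eq_square)
  then show ?thesis by (simp add: val_def ring_distribs mult_ac)
qed

lemma E_eq_iff: "E p q = E p' q' \<longleftrightarrow> p = p' \<and> q = q'"
proof
  assume "E p q = E p' q'"
  then have "c (p - p') + c (q - q') * \<eta> = 0" by (simp add: E_def c_diff algebra_simps)
  then show "p = p' \<and> q = q'" using indep by fastforce
qed simp

lemma E_eq_0_iff: "E p q = 0 \<longleftrightarrow> p = 0 \<and> q = 0"
  using indep[of p q] by (auto simp: E_def)

lemma E_1: "E 1 0 = 1" and E_c: "E p 0 = c p" and E_eta: "E 0 1 = \<eta>"
  by (simp_all add: E_def c_1)

lemma val_c: "val p 0 = poly p a"
  by (simp add: val_def)

lemma E_nonzero: "val p q \<noteq> 0 \<Longrightarrow> E p q \<noteq> 0"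
  by (auto simp: E_eq_0_iff val_def)

lemma product_vals:
  assumes "E p q * E p' q' = E r s * E r' s'"
  shows "val p q * val p' q' = val r s * val r' s'"
  using assms unfolding E_mult E_eq_iff val_mult[symmetric] by simp

lemma loc_ring_split: "loc_ring = loc_units \<union> loc_max"
  unfolding loc_ring_def loc_units_def loc_max_def by blast

lemma loc_ringI: "val p' q' \<noteq> 0 \<Longrightarrow> h * E p' q' = E p q \<Longrightarrow> h \<in> loc_ring"
  unfolding loc_ring_def by blast

lemma loc_unitsI: "val p' q' \<noteq> 0 \<Longrightarrow> val p q \<noteq> 0 \<Longrightarrow> h * E p' q' = E p q \<Longrightarrow> h \<in> loc_units"
  unfolding loc_units_def by blast

lemma loc_maxI: "val p' q' \<noteq> 0 \<Longrightarrow> val p q = 0 \<Longrightarrow> h * E p' q' = E p q \<Longrightarrow> h \<in> loc_max"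
  unfolding loc_max_def by blast

text \<open>
  The value at the point does not depend on how a function is written as a fraction.
\<close>

lemma units_max_disjoint: "h \<in> loc_units \<Longrightarrow> h \<notin> loc_max"
proof
  assume "h \<in> loc_units" "h \<in> loc_max"
  then obtain p q p' q' r s r' s' where
    1: "val p' q' \<noteq> 0" "val p q \<noteq> 0" "h * E p' q' = E p q" and
    2: "val r' s' \<noteq> 0" "val r s = 0" "h * E r' s' = E r s"
    unfolding loc_units_def loc_max_def by blast
  have "E p q * E r' s' = E r s * E p' q'"
    unfolding 1(3)[symmetric] 2(3)[symmetric] by (simp add: mult_ac)
  from product_vals[OF this] show False using 1 2 by simp
qed

lemma loc_mult_aux:
  assumes "h * E p' q' = E p q" "k * E r' s' = E r s"
  shows "(h * k) * E (p' * r' + F * q' * s') (p' * s' + q' * r') = E (p * r + F * q * s) (p * s + q * r)"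
  unfolding E_mult[symmetric] assms[symmetric] by (simp add: mult_ac)

lemma loc_units_mult: "u \<in> loc_units \<Longrightarrow> v \<in> loc_units \<Longrightarrow> u * v \<in> loc_units"
proof -
  assume "u \<in> loc_units" "v \<in> loc_units"
  then obtain p q p' q' r s r' s' where
    "val p' q' \<noteq> 0" "val p q \<noteq> 0" "u * E p' q' = E p q" and
    "val r' s' \<noteq> 0" "val r s \<noteq> 0" "v * E r' s' = E r s"
    unfolding loc_units_def by blast
  then show ?thesis
    using loc_mult_aux[of u p' q' p q v r' s' r s] by (intro loc_unitsI) (auto simp: val_mult)
qed

lemma loc_ring_mult: "u \<in> loc_ring \<Longrightarrow> v \<in> loc_ring \<Longrightarrow> u * v \<in> loc_ring"
proof -
  assume "u \<in> loc_ring" "v \<in> loc_ring"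
  then obtain p q p' q' r s r' s' where
    "val p' q' \<noteq> 0" "u * E p' q' = E p q" and
    "val r' s' \<noteq> 0" "v * E r' s' = E r s"
    unfolding loc_ring_def by blast
  then show ?thesis
    using loc_mult_aux[of u p' q' p q v r' s' r s] by (intro loc_ringI) (auto simp: val_mult)
qed

lemma loc_max_mult: "u \<in> loc_max \<Longrightarrow> v \<in> loc_ring \<Longrightarrow> u * v \<in> loc_max"
proof -
  assume "u \<in> loc_max" "v \<in> loc_ring"
  then obtain p q p' q' r s r' s' where
    "val p' q' \<noteq> 0" "val p q = 0" "u * E p' q' = E p q" and
    "val r' s' \<noteq> 0" "v * E r' s' = E r s"
    unfolding loc_ring_def loc_max_def by blast
  then show ?thesis
    using loc_mult_aux[of u p' q' p q v r' s' r s] by (intro loc_maxI) (auto simp: val_mult)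
qed

lemma E_in:
  "E p q \<in> loc_ring" "val p q \<noteq> 0 \<Longrightarrow> E p q \<in> loc_units" "val p q = 0 \<Longrightarrow> E p q \<in> loc_max"
  using loc_ringI[of 1 0 "E p q" p q] loc_unitsI[of 1 0 p q "E p q"] loc_maxI[of 1 0 p q "E p q"]
  by (simp_all add: val_c E_1)

lemma one_in: "1 \<in> loc_units" "1 \<in> loc_ring"
  using E_in[of 1 0] by (auto simp: val_c E_1)

lemma loc_units_nonzero: "u \<in> loc_units \<Longrightarrow> u \<noteq> 0"
  unfolding loc_units_def using E_nonzero by fastforce

lemma loc_units_inverse: "u \<in> loc_units \<Longrightarrow> inverse u \<in> loc_units"
proof -
  assume u: "u \<in> loc_units"
  then obtain p q p' q' where "val p' q' \<noteq> 0" "val p q \<noteq> 0" "u * E p' q' = E p q"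
    unfolding loc_units_def by blast
  moreover from this have "inverse u * E p q = E p' q'"
    using loc_units_nonzero[OF u] by (metis left_inverse mult.assoc mult_1)
  ultimately show ?thesis unfolding loc_units_def by blast
qed

lemma loc_units_powi: "u \<in> loc_units \<Longrightarrow> u powi n \<in> loc_units"
proof -
  have "u ^ k \<in> loc_units" if "u \<in> loc_units" for u k
    using that by (induction k) (auto intro: loc_units_mult one_in)
  then show "u \<in> loc_units \<Longrightarrow> u powi n \<in> loc_units"
    by (auto simp: power_int_def intro: loc_units_inverse)
qed

lemma loc_units_iff: "u \<in> loc_units \<longleftrightarrow> u \<in> loc_ring \<and> (\<exists>v\<in>loc_ring. u * v = 1)"
proof
  assume "u \<in> loc_units"
  then show "u \<in> loc_ring \<and> (\<exists>v\<in>loc_ring. u * v = 1)"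
    using loc_units_inverse[of u] loc_units_nonzero[of u] by (auto simp: loc_ring_split intro!: bexI[of _ "inverse u"])
next
  assume "u \<in> loc_ring \<and> (\<exists>v\<in>loc_ring. u * v = 1)"
  then show "u \<in> loc_units"
    using loc_max_mult[of u] units_max_disjoint[OF one_in(1)] unfolding loc_ring_split by fastforce
qed

text \<open>
  A local parameter: \<open>\<xi> - a\<close>, or \<open>\<eta>\<close> at the points with \<open>b = 0\<close>, where \<open>\<xi>\<close> is ramified.
\<close>

definition \<tau> :: 'k where "\<tau> = (if b = 0 then \<eta> else c [:- a, 1:])"

definition ram :: nat where "ram = (if b = 0 then 2 else 1)"

lemma \<tau>_max: "\<tau> \<in> loc_max"
  using E_in(3)[of 0 1] E_in(3)[of "[:- a, 1:]" 0] by (simp add: \<tau>_def E_eta E_c val_def)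

lemma \<tau>_nonzero: "\<tau> \<noteq> 0"
  using indep[of 0 1] by (auto simp: \<tau>_def c_1)

lemma \<tau>_power: "\<tau> ^ k \<in> loc_ring" "k > 0 \<Longrightarrow> \<tau> ^ k \<in> loc_max"
proof -
  show 1: "\<tau> ^ k \<in> loc_ring" for k
    using \<tau>_max loc_ring_split by (induction k) (auto intro: loc_ring_mult one_in)
  show "k > 0 \<Longrightarrow> \<tau> ^ k \<in> loc_max"
    using loc_max_mult[OF \<tau>_max 1[of "k - 1"]] by (metis Suc_diff_1 power_Suc)
qed

lemma at_ramification:
  assumes "b = 0"
  shows "val p q = poly p a" "\<tau> = \<eta>" "ram = 2"
  using assms unfolding val_def \<tau>_def ram_def by auto

text \<open>
  At a point with \<open>b = 0\<close>, write \<open>F = (\<xi> - a) F\<^sub>1\<close>; then \<open>\<xi> - a = \<eta>\<^sup>2 / F\<^sub>1\<close>, and \<open>F\<^sub>1\<close> is a unit.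
\<close>

lemma linear_decomp: "\<exists>u\<in>loc_units. c [:- a, 1:] = \<tau> ^ ram * u"
proof (cases "b = 0")
  case True
  obtain F1 where F1: "F = [:- a, 1:] * F1" "poly F1 a \<noteq> 0" using smooth[OF True] by blast
  have "c F1 \<in> loc_units" using E_in(2)[of F1 0] F1 by (simp add: E_c val_c)
  moreover have "c [:- a, 1:] = \<tau> ^ ram * inverse (c F1)"
    using loc_units_nonzero[OF \<open>c F1 \<in> loc_units\<close>]
    by (simp add: at_ramification[OF True] eta F1(1) c_mult del: mult_pCons_left)
  ultimately show ?thesis using loc_units_inverse by blast
next
  case False
  then show ?thesis using one_in by (auto simp: \<tau>_def ram_def)
qed

lemma linear_power_decomp: "\<exists>u\<in>loc_units. c ([:- a, 1:] ^ k) = \<tau> ^ (ram * k) * u"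
proof -
  obtain u where u: "u \<in> loc_units" "c [:- a, 1:] = \<tau> ^ ram * u" using linear_decomp by blast
  have "u ^ k \<in> loc_units" using u(1) by (induction k) (auto intro: loc_units_mult one_in)
  then show ?thesis using u(2) by (auto simp: c_power power_mult_distrib power_mult)
qed

lemma c_decomp:
  assumes "p \<noteq> 0"
  shows "\<exists>u\<in>loc_units. c p = \<tau> ^ (ram * order a p) * u"
proof -
  obtain q where q: "p = [:- a, 1:] ^ order a p * q" "\<not> [:- a, 1:] dvd q"
    using order_decomp[OF assms] by blast
  obtain u where u: "u \<in> loc_units" "c ([:- a, 1:] ^ order a p) = \<tau> ^ (ram * order a p) * u"
    using linear_power_decomp by blast
  have "c q \<in> loc_units" using E_in(2)[of q 0] q(2) by (simp add: E_c val_c poly_eq_0_iff_dvd)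
  then have "u * c q \<in> loc_units" using u loc_units_mult by blast
  moreover have "c p = \<tau> ^ (ram * order a p) * (u * c q)"
    using arg_cong[OF q(1), of c] u(2) by (simp add: c_mult mult.assoc)
  ultimately show ?thesis by blast
qed

lemma E_norm: "E p q * E p (- q) = c (p ^ 2 - F * q ^ 2)"
  by (simp add: E_mult E_c[symmetric] power2_eq_square mult_ac)

text \<open>
  Suppose that \<open>p + q \<eta>\<close> vanishes at \<open>(a, b)\<close>.  For \<open>b \<noteq> 0\<close> the conjugate \<open>p - q \<eta>\<close> is a unit there, so
  \<open>p + q \<eta>\<close> agrees up to a unit with its norm, which is a polynomial in \<open>\<xi>\<close>.  For \<open>b = 0\<close> the polynomial \<open>p\<close> is
  divisible by \<open>\<xi> - a = \<eta>\<^sup>2 / F\<^sub>1\<close>, and \<open>p + q \<eta>\<close> is \<open>\<eta>\<close> times a unit.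
\<close>

lemma E_decomp_aux:
  assumes "\<not> (poly p a = 0 \<and> poly q a = 0)"
  shows "\<exists>u\<in>loc_units. \<exists>n. E p q = \<tau> ^ n * u"
proof (cases "val p q = 0")
  case False
  then show ?thesis using E_in(2) by (intro bexI[of _ "E p q"] exI[of _ 0]) auto
next
  case True
  show ?thesis
  proof (cases "b = 0")
    case b: True
    with True assms have pq: "poly p a = 0" "poly q a \<noteq> 0" unfolding at_ramification[OF b] by auto
    obtain F1 where F1: "F = [:- a, 1:] * F1" "poly F1 a \<noteq> 0" using smooth[OF b] by blast
    obtain p1 where p1: "p = [:- a, 1:] * p1" using pq(1) by (metis dvdE poly_eq_0_iff_dvd)
    have "E p q * c F1 = c p1 * c F + c q * \<eta> * c F1" by (simp only: E_def p1 F1(1) c_mult ring_distribs mult_ac)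
    also have "\<dots> = \<eta> * E (q * F1) p1" by (simp add: E_def eta[symmetric] c_mult algebra_simps power2_eq_square)
    finally have "E p q * c F1 = \<eta> * E (q * F1) p1" .
    moreover have F1u: "c F1 \<in> loc_units" using E_in(2)[of F1 0] F1 by (simp add: E_c val_c)
    ultimately have "E p q = \<tau> ^ 1 * (E (q * F1) p1 * inverse (c F1))"
      using loc_units_nonzero[OF F1u] by (simp add: at_ramification[OF b] field_simps)
    moreover have "E (q * F1) p1 \<in> loc_units" using E_in(2) pq F1(2) by (simp add: at_ramification[OF b])
    ultimately show ?thesis using loc_units_mult loc_units_inverse F1u by blast
  next
    case b: False
    have "val p (- q) \<noteq> 0"
    proof
      assume "val p (- q) = 0"
      then have "poly p a = 0" "poly q a * b = 0" using True by (auto simp: val_def)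
      then show False using assms b by simp
    qed
    then have unit: "E p (- q) \<in> loc_units" by (rule E_in(2))
    show ?thesis
    proof (cases "p ^ 2 - F * q ^ 2 = 0")
      case True
      then have "E p q = 0" using E_norm[of p q] loc_units_nonzero[OF unit] by simp
      then show ?thesis using assms by (simp add: E_eq_0_iff)
    next
      case False
      then obtain u where u: "u \<in> loc_units" "c (p ^ 2 - F * q ^ 2) = \<tau> ^ (ram * order a (p ^ 2 - F * q ^ 2)) * u"
        using c_decomp by blast
      have "E p q = c (p ^ 2 - F * q ^ 2) * inverse (E p (- q))"
        using E_norm[of p q] loc_units_nonzero[OF unit] by (simp add: field_simps)
      then have "E p q = \<tau> ^ (ram * order a (p ^ 2 - F * q ^ 2)) * (u * inverse (E p (- q)))"
        using u by (simp add: mult_ac)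
      then show ?thesis using loc_units_mult[OF u(1) loc_units_inverse[OF unit]] by blast
    qed
  qed
qed

lemma E_decomp:
  assumes "E p q \<noteq> 0"
  shows "\<exists>u\<in>loc_units. \<exists>n. E p q = \<tau> ^ n * u"
proof -
  have "p \<noteq> 0 \<or> q \<noteq> 0" using assms by (auto simp: E_eq_0_iff)
  then obtain h A B where h: "h \<noteq> 0" "p = h * A" "q = h * B" "\<not> (poly A a = 0 \<and> poly B a = 0)"
    using factor_common_roots by blast
  obtain u n where u: "u \<in> loc_units" "E A B = \<tau> ^ n * u" using E_decomp_aux[OF h(4)] by blast
  obtain v where v: "v \<in> loc_units" "c h = \<tau> ^ (ram * order a h) * v" using c_decomp[OF h(1)] by blast
  have "E p q = c h * E A B" unfolding E_def h(2,3) c_mult by (simp only: ring_distribs mult_ac)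
  then have "E p q = \<tau> ^ (ram * order a h + n) * (v * u)" by (simp add: u v power_add mult_ac)
  then show ?thesis using loc_units_mult[OF v(1) u(1)] by blast
qed

lemma loc_max_eq: "loc_max = (*) \<tau> ` loc_ring"
proof
  show "(*) \<tau> ` loc_ring \<subseteq> loc_max" using loc_max_mult[OF \<tau>_max] by blast
  show "loc_max \<subseteq> (*) \<tau> ` loc_ring"
  proof
    fix h assume "h \<in> loc_max"
    then obtain p q p' q' where h: "val p' q' \<noteq> 0" "val p q = 0" "h * E p' q' = E p q"
      unfolding loc_max_def by blast
    define v where "v = inverse (E p' q')"
    have v: "v \<in> loc_units" unfolding v_def using h(1) by (intro loc_units_inverse E_in)
    have hv: "h = E p q * v" using h(3) E_nonzero[OF h(1)] by (simp add: v_def field_simps)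
    show "h \<in> (*) \<tau> ` loc_ring"
    proof (cases "E p q = 0")
      case True
      then show ?thesis using hv E_in(1)[of 0 0] by (auto simp: E_def)
    next
      case False
      then obtain u n where u: "u \<in> loc_units" "E p q = \<tau> ^ n * u" using E_decomp by blast
      have "n \<noteq> 0"
      proof
        assume "n = 0"
        then show False using u E_in(3)[OF h(2)] units_max_disjoint[OF u(1)] by simp
      qed
      then obtain k where "n = Suc k" by (cases n) auto
      then have "h = \<tau> * (\<tau> ^ k * (u * v))" using hv u by simp
      moreover have "\<tau> ^ k * (u * v) \<in> loc_ring"
        using u(1) v by (intro loc_ring_mult \<tau>_power(1)) (auto simp: loc_ring_split)
      ultimately show ?thesis by blast
    qed
  qed
qed

lemma fun_fieldI: "r \<noteq> 0 \<Longrightarrow> h * c r = c p + c q * \<eta> \<Longrightarrow> h \<in> fun_field"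
  unfolding fun_field_def E_def by blast

lemma fun_field_decomp:
  assumes "h \<in> fun_field" "h \<noteq> 0"
  shows "\<exists>u\<in>loc_units. \<exists>n. h = \<tau> powi n * u"
proof -
  obtain p q r where r: "r \<noteq> 0" "h * c r = E p q" using assms(1) unfolding fun_field_def by blast
  then have "E p q \<noteq> 0" using assms(2) by (metis c_eq_0_iff no_zero_divisors)
  then obtain u n where u: "u \<in> loc_units" "E p q = \<tau> ^ n * u" using E_decomp by blast
  obtain v where v: "v \<in> loc_units" "c r = \<tau> ^ (ram * order a r) * v" using c_decomp[OF r(1)] by blast
  define m where "m = ram * order a r"
  have "h = \<tau> powi (int n - int m) * (u * inverse v)"
    using r u v loc_units_nonzero[OF v(1)] \<tau>_nonzero
    by (simp add: power_int_diff m_def[symmetric] field_simps)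
  then show ?thesis using loc_units_mult[OF u(1) loc_units_inverse[OF v(1)]] by blast
qed

definition ord :: "'k \<Rightarrow> int" where
  "ord h = (THE n. \<exists>u\<in>loc_units. h = \<tau> powi n * u)"

lemma decomp_unique_aux:
  assumes "u \<in> loc_units" "v \<in> loc_units" "\<tau> powi n * u = \<tau> powi m * v"
  shows "\<not> n < m"
proof
  assume "n < m"
  have "u = \<tau> powi (m - n) * v"
    using assms(3) \<tau>_nonzero by (simp add: power_int_diff field_simps)
  also have "\<tau> powi (m - n) = \<tau> ^ nat (m - n)" using \<open>n < m\<close> by (simp add: power_int_def)
  finally have "u \<in> loc_max"
    using \<open>n < m\<close> \<tau>_power(2)[of "nat (m - n)"] loc_max_mult assms(2) loc_ring_split by auto
  then show False using units_max_disjoint assms(1) by blast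
qed

lemma ord_eqI:
  assumes "u \<in> loc_units" "h = \<tau> powi n * u"
  shows "ord h = n"
  unfolding ord_def
proof (rule the_equality)
  show "\<exists>u\<in>loc_units. h = \<tau> powi n * u" using assms by blast
  fix m assume "\<exists>u\<in>loc_units. h = \<tau> powi m * u"
  then obtain v where "v \<in> loc_units" "\<tau> powi n * u = \<tau> powi m * v" using assms by auto
  then show "m = n"
    using decomp_unique_aux[of u v n m] decomp_unique_aux[of v u m n] assms(1) by simp
qed

lemma ord_decomp:
  assumes "h \<in> fun_field" "h \<noteq> 0"
  shows "\<exists>u\<in>loc_units. h = \<tau> powi ord h * u"
proof -
  obtain u n where "u \<in> loc_units" "h = \<tau> powi n * u" using fun_field_decomp[OF assms] by blast
  with ord_eqI[OF this] show ?thesis by auto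
qed

lemma ord_mult:
  assumes "h \<in> fun_field" "h \<noteq> 0" "k \<in> fun_field" "k \<noteq> 0"
  shows "ord (h * k) = ord h + ord k"
proof -
  obtain u v where u: "u \<in> loc_units" "h = \<tau> powi ord h * u" "v \<in> loc_units" "k = \<tau> powi ord k * v"
    using ord_decomp assms by meson
  have "h * k = (\<tau> powi ord h * u) * (\<tau> powi ord k * v)"
    by (subst u(2), subst u(4), rule refl)
  also have "\<dots> = \<tau> powi (ord h + ord k) * (u * v)"
    using \<tau>_nonzero by (simp add: power_int_add)
  finally show ?thesis using ord_eqI loc_units_mult u by blast
qed

lemma ord_inverse:
  assumes "h \<in> fun_field" "h \<noteq> 0"
  shows "ord (inverse h) = - ord h"
proof -
  obtain u where u: "u \<in> loc_units" "h = \<tau> powi ord h * u"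
    using ord_decomp assms by meson
  have "inverse h = \<tau> powi (- ord h) * inverse u"
    by (subst u(2)) (simp add: power_int_minus)
  then show ?thesis using ord_eqI loc_units_inverse u by blast
qed

lemma ord_c: "p \<noteq> 0 \<Longrightarrow> ord (c p) = int (ram * order a p)"
  using c_decomp[of p] ord_eqI by (fastforce simp flip: power_int_of_nat)

lemma ord_E_eq_0: "val p q \<noteq> 0 \<Longrightarrow> ord (E p q) = 0"
  using ord_eqI[OF E_in(2), of p q "E p q" 0] by simp

text \<open>
  Any two uniformizers differ by a unit, so the order can be computed with any of them.
\<close>

lemma ord_uniformizer:
  assumes t: "loc_max = (*) t ` loc_ring" and u: "u \<in> loc_units"
  shows "ord (t powi n * u) = n"
proof -
  have "t \<in> (*) \<tau> ` loc_ring" using t one_in(2) loc_max_eq by (metis image_eqI mult.right_neutral)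
  then obtain w where w: "w \<in> loc_ring" "t = \<tau> * w" by blast
  have "\<tau> \<in> (*) t ` loc_ring" using t \<tau>_max by simp
  then obtain w' where w': "w' \<in> loc_ring" "\<tau> = t * w'" by blast
  have "\<tau> * (w * w') = \<tau> * 1" using w(2) w'(2) by (metis mult.assoc mult.right_neutral)
  then have "w * w' = 1" using \<tau>_nonzero by (metis mult_cancel_left)
  then have "w \<in> loc_units" using w w' loc_units_iff by blast
  then have "w powi n * u \<in> loc_units" using u loc_units_powi loc_units_mult by blast
  then show ?thesis by (rule ord_eqI) (simp add: w(2) power_int_mult_distrib mult_ac)
qed

end

section \<open>The function field and its valuations\<close>

text \<open>
  The function field of the curve depends on \<open>f\<close>, so it is not a type.  It is embedded in an algebraic
  closure of \<open>\<complex>(x)\<close>, which is a type in class \<open>field\<close> and contains a square root of \<open>f\<close>.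
\<close>

type_synonym big_field = "complex poly fract alg_closure"

lemma to_ac_eq_0_iff: "to_ac x = 0 \<longleftrightarrow> x = 0"
proof
  assume "to_ac x = 0"
  show "x = 0"
  proof (rule ccontr)
    assume "x \<noteq> 0"
    then have "to_ac x * to_ac (inverse x) = to_ac 1" by (simp flip: to_ac_mult)
    then show False using \<open>to_ac x = 0\<close> by simp
  qed
qed simp

definition of_x :: "complex poly \<Rightarrow> big_field" where "of_x p = to_ac (to_fract p)"

definition inv_x :: "complex poly fract" where "inv_x = inverse (to_fract [:0, 1:])"

definition of_inv_x :: "complex poly \<Rightarrow> big_field" where "of_inv_x p = to_ac (poly_at p inv_x)"

lemma of_x_hom: "of_x 1 = 1" "of_x (p + q) = of_x p + of_x q" "of_x (p * q) = of_x p * of_x q" "of_x (p - q) = of_x p - of_x q"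
  "of_x (- p) = - of_x p" "of_x 0 = 0"
  by (simp_all add: of_x_def)

lemma of_x_eq_0_iff [simp]: "of_x p = 0 \<longleftrightarrow> p = 0"
  by (simp add: of_x_def to_ac_eq_0_iff)

lemma of_x_eq_iff: "of_x p = of_x q \<longleftrightarrow> p = q"
  using of_x_eq_0_iff[of "p - q"] by (simp add: of_x_hom)

lemma of_x_power: "of_x (p ^ n) = of_x p ^ n"
  by (induction n) (simp_all add: of_x_hom)

definition const_fract :: "complex \<Rightarrow> complex poly fract" where "const_fract z = to_fract [:z:]"

lemma const_fract_hom: "const_fract 0 = 0" "const_fract 1 = 1"
  "const_fract (z + z') = const_fract z + const_fract z'"
  "const_fract (z * z') = const_fract z * const_fract z'"
  by (simp_all add: const_fract_def one_pCons[symmetric] flip: to_fract_add to_fract_mult)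

lemma const_fract_eq_0_iff: "const_fract z = 0 \<longleftrightarrow> z = 0"
  by (simp add: const_fract_def)

lemma const_fract_sum: "const_fract (sum h A) = (\<Sum>i\<in>A. const_fract (h i))"
  by (induction A rule: infinite_finite_induct) (simp_all add: const_fract_hom)

lemma map_const_fract_hom:
  "map_poly const_fract (p + q) = map_poly const_fract p + map_poly const_fract q"
  "map_poly const_fract (p * q) = map_poly const_fract p * map_poly const_fract q"
  by (rule poly_eqI, simp add: coeff_map_poly const_fract_hom coeff_mult const_fract_sum)+

lemma poly_at_hom: "poly_at 1 r = 1" "poly_at (p + q) r = poly_at p r + poly_at q r"
  "poly_at (p * q) r = poly_at p r * poly_at q r" "poly_at [:0, 1:] r = r"
  unfolding poly_at_def const_fract_def[symmetric]
  by (simp_all add: map_const_fract_hom const_fract_hom map_poly_pCons)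

lemma poly_at_x: "poly_at p (to_fract [:0, 1:]) = to_fract p"
  unfolding poly_at_def const_fract_def[symmetric]
proof (induction p)
  case (pCons c p)
  have "pCons c p = [:c:] + [:0, 1:] * p" by simp
  then have "to_fract (pCons c p) = const_fract c + to_fract [:0, 1:] * to_fract p"
    unfolding const_fract_def by (simp only: to_fract_add to_fract_mult)
  then show ?case using pCons by (simp add: map_poly_pCons const_fract_hom)
qed simp

lemma poly_at_reflect:
  assumes "x \<noteq> 0"
  shows "poly_at (reflect_poly p) x = x ^ degree p * poly_at p (inverse x)"
proof (cases "p = 0")
  case False
  have deg: "degree (map_poly const_fract p) = degree p"
    using False by (intro degree_map_poly) (simp add: const_fract_eq_0_iff)
  have "map_poly const_fract (reflect_poly p) = reflect_poly (map_poly const_fract p)"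
    by (rule poly_eqI) (simp add: coeff_map_poly const_fract_hom coeff_reflect_poly deg)
  then show ?thesis
    unfolding poly_at_def const_fract_def[symmetric] using poly_reflect_poly_nz[OF assms, of "map_poly const_fract p"] deg
    by simp
qed (simp add: poly_at_def)

lemma of_inv_x_hom: "of_inv_x 1 = 1" "of_inv_x (p + q) = of_inv_x p + of_inv_x q" "of_inv_x (p * q) = of_inv_x p * of_inv_x q" "of_inv_x [:0, 1:] = inverse (of_x [:0, 1:])"
  by (simp_all add: of_inv_x_def of_x_def poly_at_hom inv_x_def)

text \<open>
  The polynomial \<open>x ^ m p(1 / x)\<close>, for \<open>m \<ge> degree p\<close>.
\<close>

definition reverse_poly :: "nat \<Rightarrow> complex poly \<Rightarrow> complex poly" where
  "reverse_poly m p = [:0, 1:] ^ (m - degree p) * reflect_poly p"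

lemma reverse_poly_eq_0_iff [simp]: "reverse_poly m p = 0 \<longleftrightarrow> p = 0"
  by (simp add: reverse_poly_def)

lemma poly_at_power: "poly_at (p ^ n) r = poly_at p r ^ n"
  by (induction n) (simp_all add: poly_at_hom)

lemma poly_at_reverse:
  assumes "x \<noteq> 0" "degree p \<le> m"
  shows "poly_at (reverse_poly m p) x = x ^ m * poly_at p (inverse x)"
proof -
  have "x ^ m = x ^ (m - degree p) * x ^ degree p" using assms(2) by (simp flip: power_add)
  then show ?thesis
    unfolding reverse_poly_def poly_at_hom poly_at_power poly_at_reflect[OF assms(1)] by simp
qed

abbreviation x_fun :: big_field where "x_fun \<equiv> of_x [:0, 1:]"

lemma of_x_reverse: "degree p \<le> m \<Longrightarrow> of_x (reverse_poly m p) = x_fun ^ m * of_inv_x p"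
  using poly_at_reverse[of "to_fract [:0, 1:]" p m]
  by (simp add: of_x_def of_inv_x_def poly_at_x inv_x_def)

lemma of_inv_x_reverse: "degree p \<le> m \<Longrightarrow> of_inv_x (reverse_poly m p) = inverse x_fun ^ m * of_x p"
  using poly_at_reverse[of inv_x p m]
  by (simp add: of_x_def of_inv_x_def poly_at_x inv_x_def)

text \<open>
  The curves \<open>y\<^sup>2 = f(x)\<close> with a single point at infinity and no singular affine point.
\<close>

locale odd_hyperelliptic =
  fixes f :: "complex poly"
  assumes odd_degree: "odd (degree f)"
    and simple_roots: "poly f a = 0 \<Longrightarrow> \<exists>f1. f = [:- a, 1:] * f1 \<and> poly f1 a \<noteq> 0"
begin

definition y :: big_field where "y = (SOME y. y ^ 2 = of_x f)"

lemma y_square: "y ^ 2 = of_x f"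
  unfolding y_def by (rule someI_ex) (rule nth_root_exists, simp)

lemma f_nonzero: "f \<noteq> 0"
  using odd_degree by auto

lemma not_square:
  assumes "p ^ 2 = f * q ^ 2"
  shows "p = 0 \<and> q = 0"
proof (rule ccontr)
  assume "\<not> ?thesis"
  then have "p \<noteq> 0" "q \<noteq> 0" using assms f_nonzero by (metis mult_eq_0_iff power_eq_0_iff zero_less_numeral)+
  then have "2 * degree p = degree f + 2 * degree q"
    using arg_cong[OF assms, of degree] f_nonzero by (simp add: degree_mult_eq degree_power_eq)
  then show False using odd_degree by presburger
qed

lemma y_indep:
  assumes "of_x p + of_x q * y = 0"
  shows "p = 0 \<and> q = 0"
proof (rule not_square)
  have "of_x p ^ 2 = (of_x q * y) ^ 2" using assms by (simp add: eq_neg_iff_add_eq_0[symmetric])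
  also have "\<dots> = of_x (f * q ^ 2)" by (simp add: power_mult_distrib y_square of_x_hom of_x_power)
  finally show "p ^ 2 = f * q ^ 2" by (simp add: of_x_eq_iff flip: of_x_power)
qed

definition emb :: "ratfun \<Rightarrow> big_field" where "emb h = to_ac (fst h) + to_ac (snd h) * y"

lemma emb_mult: "emb (h \<otimes>\<^bsub>function_field f\<^esub> k) = emb h * emb k"
proof -
  have "to_ac (to_fract f) = y * y" using y_square by (simp add: of_x_def power2_eq_square)
  then show ?thesis
    by (simp add: emb_def function_field_def case_prod_beta algebra_simps)
qed

lemma emb_one: "emb (\<one>\<^bsub>function_field f\<^esub>) = 1"
  by (simp add: emb_def function_field_def)

lemma emb_zero: "emb (\<zero>\<^bsub>function_field f\<^esub>) = 0"
  by (simp add: emb_def function_field_def)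

lemma emb_poly: "emb (to_fract p, to_fract q) = of_x p + of_x q * y"
  by (simp add: emb_def of_x_def)

lemma common_denominator:
  "\<exists>p q r. r \<noteq> 0 \<and> emb h * of_x r = of_x p + of_x q * y \<and> fst h = to_fract p / to_fract r \<and> snd h = to_fract q / to_fract r"
proof -
  have "\<exists>p r. r \<noteq> 0 \<and> u = to_fract p / to_fract r" for u :: "complex poly fract"
    by (cases u) (auto simp: Fract_conv_to_fract)
  then obtain p r q s where u: "r \<noteq> 0" "fst h = to_fract p / to_fract r" "s \<noteq> 0" "snd h = to_fract q / to_fract s"
    by meson
  then have 1: "fst h = to_fract (p * s) / to_fract (r * s)" "snd h = to_fract (q * r) / to_fract (r * s)"
    by (simp_all add: mult_ac)
  have "emb h * of_x (r * s) = of_x (p * s) + of_x (q * r) * y"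
    unfolding emb_def 1 using u by (simp add: of_x_def field_simps to_ac_eq_0_iff)
  then show ?thesis using 1 u by (meson no_zero_divisors)
qed

lemma emb_eq_0D:
  assumes "emb h = 0"
  shows "h = \<zero>\<^bsub>function_field f\<^esub>"
proof -
  obtain p q r where 1: "r \<noteq> 0" "emb h * of_x r = of_x p + of_x q * y" "fst h = to_fract p / to_fract r" "snd h = to_fract q / to_fract r"
    using common_denominator by blast
  then have "p = 0 \<and> q = 0" using assms y_indep by simp
  then show ?thesis using 1 by (simp add: function_field_def prod_eq_iff)
qed

lemma inj_emb: "emb h = emb k \<longleftrightarrow> h = k"
proof
  assume "emb h = emb k"
  then have "emb (fst h - fst k, snd h - snd k) = 0" by (simp add: emb_def algebra_simps)
  from emb_eq_0D[OF this] show "h = k" by (simp add: function_field_def prod_eq_iff)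
qed simp

lemma emb_eq_0_iff: "emb h = 0 \<longleftrightarrow> h = \<zero>\<^bsub>function_field f\<^esub>"
  using emb_eq_0D emb_zero by metis

lemma in_range_emb:
  assumes "r \<noteq> 0" "k * of_x r = of_x p + of_x q * y"
  shows "k \<in> range emb"
proof -
  have "k = emb (to_fract p / to_fract r, to_fract q / to_fract r)"
    using assms by (simp add: emb_def field_simps of_x_def[symmetric])
  then show ?thesis by blast
qed

lemma range_emb_mult: "h \<in> range emb \<Longrightarrow> k \<in> range emb \<Longrightarrow> h * k \<in> range emb"
  by (auto simp flip: emb_mult)

lemma range_emb_inverse:
  assumes "k \<in> range emb"
  shows "inverse k \<in> range emb"
proof (cases "k = 0")
  case True
  then show ?thesis using assms by simp
next
  case False
  obtain p q r where 1: "r \<noteq> 0" "k * of_x r = of_x p + of_x q * y"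
    using assms common_denominator by blast
  have nz: "p ^ 2 - f * q ^ 2 \<noteq> 0"
  proof
    assume "p ^ 2 - f * q ^ 2 = 0"
    then have "p = 0 \<and> q = 0" by (intro not_square) simp
    then show False using 1 False by (simp add: of_x_hom)
  qed
  have "(of_x p + of_x q * y) * (of_x p - of_x q * y) = of_x p ^ 2 - of_x q ^ 2 * y ^ 2"
    by (simp add: algebra_simps power2_eq_square)
  then have norm: "(of_x p + of_x q * y) * (of_x p - of_x q * y) = of_x (p ^ 2 - f * q ^ 2)"
    by (simp add: y_square of_x_hom of_x_power)
  have "inverse k * of_x (p ^ 2 - f * q ^ 2) = of_x (p * r) + of_x (- q * r) * y"
  proof -
    have "inverse k * (k * of_x r * (of_x p - of_x q * y)) = of_x r * (of_x p - of_x q * y)"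
      using False by simp
    then show ?thesis unfolding norm[symmetric] 1(2)[symmetric] by (simp add: of_x_hom algebra_simps)
  qed
  then show ?thesis using in_range_emb nz by blast
qed

lemma emb_inv:
  assumes "emb h \<noteq> 0"
  shows "emb (inv\<^bsub>function_field f\<^esub> h) = inverse (emb h)"
proof -
  obtain k where k: "emb k = inverse (emb h)" using range_emb_inverse[of "emb h"] by (metis rangeE rangeI)
  have iff: "h \<otimes>\<^bsub>function_field f\<^esub> k' = \<one>\<^bsub>function_field f\<^esub> \<longleftrightarrow> k' = k" for k'
  proof -
    have "h \<otimes>\<^bsub>function_field f\<^esub> k' = \<one>\<^bsub>function_field f\<^esub> \<longleftrightarrow> emb h * emb k' = 1"
      by (metis emb_mult emb_one inj_emb)
    also have "\<dots> \<longleftrightarrow> emb k' = emb k" using assms by (simp add: k field_simps)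
    finally show ?thesis by (simp add: inj_emb)
  qed
  have "k \<otimes>\<^bsub>function_field f\<^esub> h = \<one>\<^bsub>function_field f\<^esub>"
    using assms by (simp add: k emb_mult emb_one flip: inj_emb)
  then have "inv\<^bsub>function_field f\<^esub> h = k"
    unfolding m_inv_def using iff by (intro the_equality) (auto simp: function_field_def)
  then show ?thesis by (simp add: k)
qed

lemma emb_pow:
  fixes n :: nat
  shows "emb (h [^]\<^bsub>function_field f\<^esub> n) = emb h ^ n"
  by (induction n) (simp_all add: nat_pow_def emb_one emb_mult)

lemma emb_int_pow:
  fixes n :: int
  assumes "emb h \<noteq> 0"
  shows "emb (h [^]\<^bsub>function_field f\<^esub> n) = emb h powi n"
proof -
  have 1: "h [^]\<^bsub>function_field f\<^esub> n =
      (if n < 0 then inv\<^bsub>function_field f\<^esub> (h [^]\<^bsub>function_field f\<^esub> nat (- n)) else h [^]\<^bsub>function_field f\<^esub> nat n)"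
    by (simp add: int_pow_def nat_pow_def Let_def)
  show ?thesis
  proof (cases "n < 0")
    case True
    have "emb (h [^]\<^bsub>function_field f\<^esub> nat (- n)) \<noteq> 0" using assms by (simp only: emb_pow) simp
    then show ?thesis using True 
      by (simp add: 1 emb_inv power_int_def power_inverse del: pow_nat) (simp only: emb_pow)
  next
    case False
    then show ?thesis
      by (simp add: 1 power_int_def del: pow_nat) (simp only: emb_pow)
  qed
qed

fun chart_base :: "curve_point \<Rightarrow> complex poly \<Rightarrow> big_field" where
  "chart_base (Affine a b) = of_x" | "chart_base Infinity = of_inv_x"

fun chart_eta :: "curve_point \<Rightarrow> big_field" where
  "chart_eta (Affine a b) = y" | "chart_eta Infinity = y * inverse x_fun ^ ((degree f + 1) div 2)"

fun chart_poly :: "curve_point \<Rightarrow> complex poly" where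
  "chart_poly (Affine a b) = f" | "chart_poly Infinity = [:0, 1:] * reflect_poly f"

fun chart_xi0 :: "curve_point \<Rightarrow> complex" where
  "chart_xi0 (Affine a b) = a" | "chart_xi0 Infinity = 0"

fun chart_eta0 :: "curve_point \<Rightarrow> complex" where
  "chart_eta0 (Affine a b) = b" | "chart_eta0 Infinity = 0"

text \<open>
  In the coordinates \<open>1 / x\<close> and \<open>y / x ^ (g + 1)\<close> the right hand side of the equation is the reversed
  polynomial of \<open>f\<close> times one more factor \<open>1 / x\<close>, as \<open>f\<close> has odd degree.  So \<open>(0, 0)\<close> is a smooth
  point with \<open>b = 0\<close>.
\<close>

lemma infinity_chart:
  "curve_chart of_inv_x (chart_eta Infinity) (chart_poly Infinity) 0 0"
proof
  define k where "k = (degree f + 1) div 2"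
  have k: "k + k = Suc (degree f)" using odd_degree by (simp add: k_def) presburger
  show "of_inv_x 1 = 1" "of_inv_x (p + q) = of_inv_x p + of_inv_x q" "of_inv_x (p * q) = of_inv_x p * of_inv_x q" for p q by (simp_all add: of_inv_x_hom)
  have "(y * inverse x_fun ^ k) ^ 2 = inverse x_fun * (inverse x_fun ^ degree f * of_x f)"
  proof -
    have "inverse x_fun ^ k * inverse x_fun ^ k = inverse x_fun * inverse x_fun ^ degree f"
      by (simp only: k power_add[symmetric] power_Suc)
    then have "(inverse x_fun ^ k) ^ 2 = inverse x_fun * inverse x_fun ^ degree f" by (simp only: power2_eq_square)
    then show ?thesis by (simp only: power_mult_distrib y_square mult_ac)
  qed
  also have "\<dots> = of_inv_x ([:0, 1:] * reflect_poly f)"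
    using of_inv_x_reverse[of f "degree f"] by (simp only: of_inv_x_hom) (simp add: reverse_poly_def)
  finally show "chart_eta Infinity ^ 2 = of_inv_x (chart_poly Infinity)" by (simp only: chart_eta.simps chart_poly.simps k_def)
  show "0\<^sup>2 = poly (chart_poly Infinity) 0" by simp
  show "\<exists>F1. chart_poly Infinity = [:- 0, 1:] * F1 \<and> poly F1 0 \<noteq> 0"
    using f_nonzero by (intro exI[of _ "reflect_poly f"]) simp
  show "p = 0 \<and> q = 0" if "of_inv_x p + of_inv_x q * chart_eta Infinity = 0" for p q
  proof -
    define m where "m = degree p + degree q + k"
    have "of_x (reverse_poly m p) + of_x (reverse_poly (m - k) q) * y
        = x_fun ^ m * of_inv_x p + x_fun ^ (m - k) * of_inv_x q * y"
      by (simp add: of_x_reverse m_def)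
    also have "\<dots> = x_fun ^ m * (of_inv_x p + of_inv_x q * (y * inverse x_fun ^ k))"
    proof -
      have "x_fun ^ m * inverse x_fun ^ k = x_fun ^ (m - k)"
        by (simp add: m_def power_diff power_inverse field_simps power_add)
      then show ?thesis by (simp add: algebra_simps)
    qed
    also have "\<dots> = 0" using that by (simp add: k_def)
    finally show ?thesis using y_indep reverse_poly_eq_0_iff by blast
  qed
qed

lemma chart_at:
  assumes "P \<in> hyperelliptic_curve f"
  shows "curve_chart (chart_base P) (chart_eta P) (chart_poly P) (chart_xi0 P) (chart_eta0 P)"
proof (cases P)
  case Infinity
  then show ?thesis using infinity_chart by simp
next
  case (Affine a b)
  then have "b ^ 2 = poly f a" using assms by (auto simp: hyperelliptic_curve_def)
  then have "curve_chart of_x y f a b"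
    by unfold_locales (use y_indep y_square simple_roots in \<open>auto simp: of_x_hom\<close>)
  then show ?thesis using Affine by simp
qed

lemma emb_chart_fun: "emb (chart_fun f P p q) = chart_base P p + chart_base P q * chart_eta P"
proof (cases P)
  case Infinity
  then show ?thesis by (simp add: Let_def emb_def of_inv_x_def inv_x_def of_x_def)
qed (simp add: emb_poly)

lemma chart_val_eq: "chart_val P p q = poly p (chart_xi0 P) + poly q (chart_xi0 P) * chart_eta0 P"
  by (cases P) simp_all

definition valuation :: "curve_point \<Rightarrow> big_field \<Rightarrow> int" where
  "valuation P = curve_chart.ord (chart_base P) (chart_eta P) (chart_xi0 P) (chart_eta0 P)"

context
  fixes P assumes P: "P \<in> hyperelliptic_curve f"
begin

interpretation ch: curve_chart "chart_base P" "chart_eta P" "chart_poly P" "chart_xi0 P" "chart_eta0 P"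
  by (rule chart_at[OF P])

lemma range_emb_subset_fun_field: "range emb \<subseteq> ch.fun_field"
proof
  fix k assume "k \<in> range emb"
  then obtain p q r where 1: "r \<noteq> 0" "k * of_x r = of_x p + of_x q * y"
    using common_denominator by blast
  show "k \<in> ch.fun_field"
  proof (cases P)
    case (Affine a b)
    then show ?thesis unfolding ch.fun_field_def ch.E_def using 1 by auto
  next
    case Infinity
    define l where "l = (degree f + 1) div 2"
    define m where "m = degree p + degree q + degree r + l"
    have le: "degree r \<le> m" "degree p \<le> m" "degree q \<le> m - l" by (simp_all add: m_def)
    have e: "inverse x_fun ^ m = inverse x_fun ^ (m - l) * inverse x_fun ^ l"
      by (simp add: m_def flip: power_add)
    have "k * of_inv_x (reverse_poly m r) = inverse x_fun ^ m * (k * of_x r)" by (simp add: of_inv_x_reverse[OF le(1)])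
    also have "\<dots> = inverse x_fun ^ m * of_x p + inverse x_fun ^ m * (of_x q * y)"
      unfolding 1(2) by (rule distrib_left)
    also have "inverse x_fun ^ m * (of_x q * y) = of_inv_x (reverse_poly (m - l) q) * (y * inverse x_fun ^ l)"
      unfolding of_inv_x_reverse[OF le(3)] e by (simp only: mult_ac)
    also have "inverse x_fun ^ m * of_x p = of_inv_x (reverse_poly m p)" by (simp add: of_inv_x_reverse[OF le(2)])
    finally have "k * of_inv_x (reverse_poly m r) = of_inv_x (reverse_poly m p) + of_inv_x (reverse_poly (m - l) q) * (y * inverse x_fun ^ l)" .
    then show ?thesis
      using 1(1) by (intro ch.fun_fieldI) (auto simp: Infinity l_def)
  qed
qed

lemma E_eq_emb: "ch.E p q = emb (chart_fun f P p q)"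
  by (simp add: emb_chart_fun ch.E_def)

lemma val_eq_chart_val: "ch.val p q = chart_val P p q"
  by (simp add: chart_val_eq ch.val_def)

lemma emb_local_ring: "emb h \<in> ch.loc_ring \<longleftrightarrow> h \<in> local_ring f P"
  unfolding ch.loc_ring_def local_ring_def
  by (simp add: E_eq_emb val_eq_chart_val flip: emb_mult inj_emb)

lemma loc_ring_subset: "ch.loc_ring \<subseteq> range emb"
proof
  fix k assume "k \<in> ch.loc_ring"
  then obtain p q p' q' where 1: "ch.val p' q' \<noteq> 0" "k * ch.E p' q' = ch.E p q" unfolding ch.loc_ring_def by blast
  then have "k = ch.E p q * inverse (ch.E p' q')" using ch.E_nonzero[OF 1(1)] by (simp add: field_simps)
  then show "k \<in> range emb" using range_emb_mult range_emb_inverse E_eq_emb by (metis rangeI)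
qed

lemma image_local_ring: "emb ` local_ring f P = ch.loc_ring"
  using loc_ring_subset emb_local_ring by auto

lemma emb_local_units: "emb h \<in> ch.loc_units \<longleftrightarrow> h \<in> local_units f P"
proof -
  have "emb h \<in> ch.loc_units \<longleftrightarrow> emb h \<in> ch.loc_ring \<and> (\<exists>v\<in>emb ` local_ring f P. emb h * v = 1)"
    unfolding image_local_ring by (rule ch.loc_units_iff)
  also have "\<dots> \<longleftrightarrow> h \<in> local_units f P"
    unfolding local_units_def by (simp add: emb_local_ring emb_one flip: emb_mult inj_emb)
  finally show ?thesis .
qed

lemma uniformizer_iff: "uniformizer f P t \<longleftrightarrow> ch.loc_max = (*) (emb t) ` ch.loc_ring"
proof -
  have inj: "inj emb" by (auto intro!: injI simp: inj_emb)
  have "ch.loc_units \<subseteq> range emb" using loc_ring_subset ch.loc_ring_split by blast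
  then have "emb ` local_units f P = ch.loc_units" using emb_local_units by auto
  then have "emb ` (local_ring f P - local_units f P) = ch.loc_ring - ch.loc_units"
    by (simp add: image_set_diff[OF inj] image_local_ring)
  also have "\<dots> = ch.loc_max" using ch.loc_ring_split ch.units_max_disjoint by blast
  finally have "emb ` (local_ring f P - local_units f P) = ch.loc_max" .
  moreover have "emb ` ((\<lambda>h. t \<otimes>\<^bsub>function_field f\<^esub> h) ` local_ring f P) = (*) (emb t) ` ch.loc_ring"
    unfolding image_local_ring[symmetric] image_image by (simp add: emb_mult)
  ultimately show ?thesis
    unfolding uniformizer_def using inj_image_eq_iff[OF inj] by metis
qed

text \<open>
  The embedding maps local rings, units and uniformizers to those of the chart; so the definite
  description in \<open>ord_at\<close> has a unique solution.
\<close>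

lemma ord_at_eq_valuation:
  assumes "h \<noteq> \<zero>\<^bsub>function_field f\<^esub>"
  shows "ord_at f P h = valuation P (emb h)"
  unfolding ord_at_def
proof (rule the_equality)
  have nz: "emb h \<noteq> 0" using assms by (simp add: emb_eq_0_iff)
  obtain u where u: "u \<in> ch.loc_units" "emb h = ch.\<tau> powi valuation P (emb h) * u"
    using ch.ord_decomp[of "emb h"] range_emb_subset_fun_field nz unfolding valuation_def by blast
  have "ch.\<tau> \<in> range emb" "u \<in> range emb"
    using u(1) ch.\<tau>_max loc_ring_subset ch.loc_ring_split by blast+
  then obtain t u' where t: "emb t = ch.\<tau>" and u': "emb u' = u" unfolding image_iff by metis
  show "\<exists>t u. uniformizer f P t \<and> u \<in> local_units f P \<and>
      h = t [^]\<^bsub>function_field f\<^esub> valuation P (emb h) \<otimes>\<^bsub>function_field f\<^esub> u"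
  proof (intro exI conjI)
    show "uniformizer f P t" using ch.loc_max_eq by (simp add: uniformizer_iff t)
    show "u' \<in> local_units f P" using u(1) by (simp add: u' flip: emb_local_units)
    have "emb h = emb (t [^]\<^bsub>function_field f\<^esub> valuation P (emb h) \<otimes>\<^bsub>function_field f\<^esub> u')"
      using u(2) ch.\<tau>_nonzero by (simp add: emb_mult emb_int_pow t u')
    then show "h = t [^]\<^bsub>function_field f\<^esub> valuation P (emb h) \<otimes>\<^bsub>function_field f\<^esub> u'"
      by (simp only: inj_emb)
  qed
next
  fix n :: int assume "\<exists>t u. uniformizer f P t \<and> u \<in> local_units f P \<and>
      h = t [^]\<^bsub>function_field f\<^esub> n \<otimes>\<^bsub>function_field f\<^esub> u"
  then obtain t u where t: "uniformizer f P t" "u \<in> local_units f P"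
    "h = t [^]\<^bsub>function_field f\<^esub> n \<otimes>\<^bsub>function_field f\<^esub> u" by blast
  have max: "ch.loc_max = (*) (emb t) ` ch.loc_ring" using t(1) by (simp add: uniformizer_iff)
  have "emb t \<noteq> 0" using max ch.\<tau>_max ch.\<tau>_nonzero by force
  then have "emb h = emb t powi n * emb u" using t(3) by (simp add: emb_mult emb_int_pow)
  then show "n = valuation P (emb h)"
    using ch.ord_uniformizer[OF max, of "emb u" n] t(2) by (simp add: emb_local_units valuation_def)
qed

lemma valuation_mult:
  "h \<in> range emb \<Longrightarrow> h \<noteq> 0 \<Longrightarrow> k \<in> range emb \<Longrightarrow> k \<noteq> 0 \<Longrightarrow>
    valuation P (h * k) = valuation P h + valuation P k"
  unfolding valuation_def using range_emb_subset_fun_field by (intro ch.ord_mult) auto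

lemma valuation_inverse:
  "h \<in> range emb \<Longrightarrow> h \<noteq> 0 \<Longrightarrow> valuation P (inverse h) = - valuation P h"
  unfolding valuation_def using range_emb_subset_fun_field by (intro ch.ord_inverse) auto

end

lemma valuation_affine_of_x:
  assumes "Affine a b \<in> hyperelliptic_curve f" "p \<noteq> 0"
  shows "valuation (Affine a b) (of_x p) = (if b = 0 then 2 else 1) * int (order a p)"
proof -
  interpret ch: curve_chart of_x y f a b using chart_at[OF assms(1)] by simp
  show ?thesis using ch.ord_c[OF assms(2)] by (simp add: valuation_def ch.ram_def)
qed

lemma valuation_affine_eq_0:
  assumes "Affine a b \<in> hyperelliptic_curve f" "poly p a + poly q a * b \<noteq> 0"
  shows "valuation (Affine a b) (of_x p + of_x q * y) = 0"
proof -
  interpret ch: curve_chart of_x y f a b using chart_at[OF assms(1)] by simp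
  show ?thesis using ch.ord_E_eq_0[of p q] assms(2) by (simp add: valuation_def ch.val_def ch.E_def)
qed

lemma valuation_y:
  assumes "Affine a 0 \<in> hyperelliptic_curve f"
  shows "valuation (Affine a 0) y = 1"
proof -
  interpret ch: curve_chart of_x y f a 0 using chart_at[OF assms(1)] by simp
  show ?thesis using ch.ord_eqI[OF ch.one_in(1), of y 1] by (simp add: valuation_def ch.\<tau>_def)
qed

text \<open>
  Up to a unit, \<open>p(x)\<close> is \<open>x ^ degree p\<close>, and \<open>1 / x\<close> has order \<open>2\<close> at infinity.
\<close>

lemma valuation_infinity_of_x:
  assumes "p \<noteq> 0"
  shows "valuation Infinity (of_x p) = - 2 * int (degree p)"
proof -
  define w where "w = chart_eta Infinity"
  interpret ch: curve_chart of_inv_x w "chart_poly Infinity" 0 0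
    unfolding w_def by (rule infinity_chart)
  have val: "valuation Infinity = ch.ord" by (simp add: valuation_def w_def)
  define d where "d = degree p"
  have of_inv_x: "of_inv_x q \<in> ch.fun_field" for q
    by (rule ch.fun_fieldI[of 1 _ q 0]) (simp_all add: ch.c_1)
  have eq: "of_x p * of_inv_x ([:0, 1:] ^ d) = of_inv_x (reflect_poly p)"
    using of_inv_x_reverse[of p d] by (simp add: reverse_poly_def d_def ch.c_power of_inv_x_hom mult.commute)
  have of_x: "of_x p \<in> ch.fun_field"
    by (rule ch.fun_fieldI[of "[:0, 1:] ^ d" _ "reflect_poly p" 0]) (simp_all add: eq)
  have "ch.ord (of_inv_x ([:0, 1:] ^ d)) = 2 * int d"
    using ch.ord_c[of "[:0, 1:] ^ d"] order_power_n_n[of "0::complex" d] by (simp add: ch.ram_def)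
  moreover have "order 0 (reflect_poly p) = 0" using assms by (intro order_0I) simp
  then have "ch.ord (of_inv_x (reflect_poly p)) = 0" using assms ch.ord_c[of "reflect_poly p"] by simp
  ultimately show ?thesis
    using ch.ord_mult[OF of_x _ of_inv_x, of "[:0, 1:] ^ d"] assms unfolding eq val by (simp add: d_def)
qed

end

section \<open>Functions whose divisor is a multiple\<close>

lemma complex_degree_eq_sum_order:
  fixes p :: "complex poly"
  assumes "p \<noteq> 0"
  shows "degree p = (\<Sum>a | poly p a = 0. order a p)"
proof -
  have "degree p = size (proots p)" by (simp add: size_proots_complex)
  then show ?thesis using assms by (simp add: size_multiset_overloaded_eq)
qed

context odd_hyperelliptic
begin

lemma emb_in_range: "of_x p + of_x q * y \<in> range emb" "of_x p \<in> range emb"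
  using in_range_emb[of 1 "of_x p + of_x q * y" p q] in_range_emb[of 1 "of_x p" p 0] by (auto simp: of_x_hom)

lemma affine_in_curve: "Affine a b \<in> hyperelliptic_curve f \<longleftrightarrow> b ^ 2 = poly f a"
  by (auto simp: hyperelliptic_curve_def)

lemma conjugate_product: "(of_x A + of_x B * y) * (of_x A + of_x (- B) * y) = of_x (A ^ 2 - f * B ^ 2)"
proof -
  have "(of_x A + of_x B * y) * (of_x A + of_x (- B) * y) = of_x A ^ 2 - of_x B ^ 2 * y ^ 2"
    by (simp add: of_x_hom algebra_simps power2_eq_square)
  then show ?thesis by (simp add: y_square of_x_hom of_x_power)
qed

lemma norm_nonzero:
  assumes "\<And>a. \<not> (poly A a = 0 \<and> poly B a = 0)"
  shows "A ^ 2 - f * B ^ 2 \<noteq> 0"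
proof
  assume "A ^ 2 - f * B ^ 2 = 0"
  then have "A = 0 \<and> B = 0" by (intro not_square) simp
  then show False using assms by auto
qed

text \<open>
  At a branch point \<open>A\<close> has even order, and at least \<open>2\<close> here, whereas \<open>B y\<close> has order \<open>1\<close>.
\<close>

lemma valuation_at_ramification:
  assumes "poly f a = 0" "poly A a = 0" "poly B a \<noteq> 0"
  shows "valuation (Affine a 0) (of_x A + of_x B * y) = 1"
proof -
  let ?P = "Affine a 0"
  have P: "?P \<in> hyperelliptic_curve f" using assms(1) by (simp add: affine_in_curve)
  obtain f1 where f1: "f = [:- a, 1:] * f1" "poly f1 a \<noteq> 0" using simple_roots[OF assms(1)] by blast
  obtain A1 where A1: "A = [:- a, 1:] * A1" using assms(2) by (metis dvdE poly_eq_0_iff_dvd)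
  have "f1 \<noteq> 0" using f1 by auto
  have ne: "of_x A + of_x B * y \<noteq> 0" "of_x (B * f1) + of_x A1 * y \<noteq> 0"
    using y_indep[of A B] y_indep[of "B * f1" A1] assms(3) f1(2) by auto
  have "(of_x A + of_x B * y) * of_x f1 = of_x A1 * of_x f + of_x B * y * of_x f1"
    unfolding A1 f1(1) by (simp only: of_x_hom ring_distribs mult_ac)
  also have "\<dots> = y * (of_x (B * f1) + of_x A1 * y)"
    unfolding y_square[symmetric] by (simp only: of_x_hom ring_distribs mult_ac add_ac power2_eq_square)
  finally have eq: "(of_x A + of_x B * y) * of_x f1 = y * (of_x (B * f1) + of_x A1 * y)" .
  have ynz: "y \<noteq> 0" using y_square f_nonzero by auto
  have y_in: "y \<in> range emb" using emb_in_range(1)[of 0 1] by (simp add: of_x_hom)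
  have "order a f1 = 0" using f1(2) by (rule order_0I)
  then have "valuation ?P (of_x A + of_x B * y) = valuation ?P ((of_x A + of_x B * y) * of_x f1)"
    using valuation_mult[OF P emb_in_range(1) ne(1) emb_in_range(2), of f1] valuation_affine_of_x[OF P, of f1] \<open>f1 \<noteq> 0\<close>
    by simp
  also have "\<dots> = valuation ?P y + valuation ?P (of_x (B * f1) + of_x A1 * y)"
    unfolding eq by (rule valuation_mult[OF P y_in ynz emb_in_range(1) ne(2)])
  also have "\<dots> = 1"
    using valuation_y[OF P] valuation_affine_eq_0[OF P, of "B * f1" A1] assms(3) f1(2) by simp
  finally show ?thesis .
qed

text \<open>
  Here \<open>k\<close> is the product of \<open>A + B y\<close> and \<open>h / r\<close>, a function of \<open>x\<close>.  Let \<open>b \<noteq> 0\<close>, and let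
  \<open>A + B y\<close> vanish at \<open>P = (a, b)\<close>.  Then it does not vanish at \<open>\<iota> P = (a, - b)\<close>, since \<open>A\<close> and \<open>B\<close>
  have no common root.  So the norm has at \<open>a\<close> the order of \<open>A + B y\<close> at \<open>P\<close>, and this is the difference
  \<open>N (m P - m (\<iota> P))\<close> of the orders of \<open>k\<close> at \<open>P\<close> and \<open>\<iota> P\<close>, because a function of \<open>x\<close> has the same order at
  both.  At a branch point the order of \<open>k\<close> is even as \<open>N\<close> is, so \<open>A + B y\<close> cannot have order \<open>1\<close>, and
  the norm does not vanish.
\<close>

lemma norm_order:
  assumes k: "k \<in> range emb" "k \<noteq> 0" "k * of_x r = of_x h * (of_x A + of_x B * y)" "r \<noteq> 0" "h \<noteq> 0"
    and nocommon: "\<And>a. \<not> (poly A a = 0 \<and> poly B a = 0)"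
    and N: "even N"
    and val: "\<And>P. P \<in> hyperelliptic_curve f \<Longrightarrow> valuation P k = N * m P"
    and m: "\<And>a b. Affine a b \<in> hyperelliptic_curve f \<Longrightarrow> m (Affine a b) \<ge> 0" and "N > 0"
  shows "\<exists>b. b ^ 2 = poly f a \<and> N dvd int (order a (A ^ 2 - f * B ^ 2))
     \<and> int (order a (A ^ 2 - f * B ^ 2)) \<le> N * m (Affine a b)"
proof -
  define M where "M = A ^ 2 - f * B ^ 2"
  have "M \<noteq> 0" unfolding M_def using nocommon by (rule norm_nonzero)
  have E: "of_x A + of_x B * y \<noteq> 0" using k by auto
  have E': "of_x A + of_x (- B) * y \<noteq> 0"
    using conjugate_product[of A B] \<open>M \<noteq> 0\<close> by (auto simp: M_def)
  have valE: "valuation P k + valuation P (of_x r) = valuation P (of_x h) + valuation P (of_x A + of_x B * y)"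
    if "P \<in> hyperelliptic_curve f" for P
    using valuation_mult[OF that k(1,2) emb_in_range(2), of r]
      valuation_mult[OF that emb_in_range(2) _ emb_in_range(1) E, of h] k(3-5) by simp
  have valM: "valuation P (of_x M) = valuation P (of_x A + of_x B * y) + valuation P (of_x A + of_x (- B) * y)"
    if "P \<in> hyperelliptic_curve f" for P
    using valuation_mult[OF that emb_in_range(1) E emb_in_range(1) E'] by (simp add: conjugate_product M_def)
  obtain b where b: "b ^ 2 = poly f a" using nth_root_exists[of 2 "poly f a"] by auto
  have zero: ?thesis if "poly M a \<noteq> 0"
    using that b m[of a b] \<open>N > 0\<close> by (intro exI[of _ b]) (auto simp: order_0I M_def affine_in_curve)
  show ?thesis
  proof (cases "b = 0")
    case True
    have P: "Affine a 0 \<in> hyperelliptic_curve f" using b True by (simp add: affine_in_curve)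
    have "poly f a = 0" using b True by simp
    have "poly A a \<noteq> 0"
    proof
      assume A0: "poly A a = 0"
      then have "valuation (Affine a 0) (of_x A + of_x B * y) = 1"
        using valuation_at_ramification[OF \<open>poly f a = 0\<close>] nocommon by blast
      then have "N * m (Affine a 0) + 2 * int (order a r) = 2 * int (order a h) + 1"
        using valE[OF P] val[OF P] valuation_affine_of_x[OF P] k by simp
      moreover obtain t where "N * m (Affine a 0) = 2 * t" using N by (metis dvd_mult2 dvdE)
      ultimately show False by presburger
    qed
    then show ?thesis using \<open>poly f a = 0\<close> by (intro zero) (simp add: M_def)
  next
    case False
    have main: ?thesis if b: "b ^ 2 = poly f a" "b \<noteq> 0" and root: "poly A a + poly B a * b = 0" for b
    proof -
      have P: "Affine a b \<in> hyperelliptic_curve f" "Affine a (- b) \<in> hyperelliptic_curve f"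
        using b by (simp_all add: affine_in_curve)
      have "poly A a - poly B a * b \<noteq> 0"
      proof
        assume "poly A a - poly B a * b = 0"
        then have "poly A a = 0" "poly B a * b = 0" using root by (auto simp: algebra_simps)
        then show False using nocommon b(2) by simp
      qed
      then have "valuation (Affine a (- b)) (of_x A + of_x B * y) = 0"
        "valuation (Affine a b) (of_x A + of_x (- B) * y) = 0"
        using valuation_affine_eq_0[OF P(2), of A B] valuation_affine_eq_0[OF P(1), of A "- B"] by simp_all
      then have "N * m (Affine a (- b)) + int (order a r) = int (order a h)"
        "int (order a M) = valuation (Affine a b) (of_x A + of_x B * y)"
        using valE[OF P(2)] valM[OF P(1)] val[OF P(2)] valuation_affine_of_x[OF P(2)] valuation_affine_of_x[OF P(1)]
          k b(2) \<open>M \<noteq> 0\<close> by simp_all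
      then have "int (order a M) = N * (m (Affine a b) - m (Affine a (- b)))"
        using valE[OF P(1)] val[OF P(1)] valuation_affine_of_x[OF P(1)] k b(2) by (simp add: algebra_simps)
      moreover have "N * (m (Affine a b) - m (Affine a (- b))) \<le> N * m (Affine a b)"
        using m[OF P(2)] \<open>N > 0\<close> by simp
      ultimately show ?thesis using b(1) unfolding M_def[symmetric] by (metis dvd_triv_left)
    qed
    have fac: "poly M a = (poly A a + poly B a * b) * (poly A a + poly B a * (- b))"
      using b by (simp add: M_def algebra_simps power2_eq_square)
    show ?thesis
    proof (cases "poly M a = 0")
      case True
      then consider "poly A a + poly B a * b = 0" | "poly A a + poly B a * (- b) = 0"
        unfolding fac by auto
      then show ?thesis using main[of b] main[of "- b"] b False by cases auto
    qed (rule zero)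
  qed
qed

lemma norm_is_power:
  assumes k: "k \<in> range emb" "k \<noteq> 0" and N: "even N" "N > 0"
    and val: "\<And>P. P \<in> hyperelliptic_curve f \<Longrightarrow> valuation P k = int N * m P"
    and m: "\<And>a b. Affine a b \<in> hyperelliptic_curve f \<Longrightarrow> m (Affine a b) = int (card {i\<in>I. Q i = Affine a b})"
    and "finite I"
  shows "\<exists>r h A B U. r \<noteq> 0 \<and> h \<noteq> 0 \<and> k * of_x r = of_x h * (of_x A + of_x B * y)
    \<and> (\<forall>a. \<not> (poly A a = 0 \<and> poly B a = 0)) \<and> A ^ 2 - f * B ^ 2 = U ^ N \<and> degree U \<le> card I"
proof -
  obtain p q r where r: "r \<noteq> 0" "k * of_x r = of_x p + of_x q * y" using k(1) common_denominator by blast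
  have "p \<noteq> 0 \<or> q \<noteq> 0" using r k(2) by (auto simp: of_x_hom)
  then obtain h A B where h: "h \<noteq> 0" "p = h * A" "q = h * B" "\<And>a. \<not> (poly A a = 0 \<and> poly B a = 0)"
    using factor_common_roots by blast
  have k3: "k * of_x r = of_x h * (of_x A + of_x B * y)" using r(2) by (simp add: h of_x_hom algebra_simps)
  define M where "M = A ^ 2 - f * B ^ 2"
  have "M \<noteq> 0" unfolding M_def using h(4) by (rule norm_nonzero)
  have "\<exists>b. b ^ 2 = poly f a \<and> int N dvd int (order a M) \<and> int (order a M) \<le> int N * m (Affine a b)" for a
    unfolding M_def by (rule norm_order[OF k k3 r(1) h(1) h(4)]) (use N val m in auto)
  \<comment> \<open>a choice of one point over each \<open>a\<close>; different roots of \<open>U\<close> then account for different indices \<open>i\<close>\<close>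
  then obtain b where b: "\<And>a. b a ^ 2 = poly f a" "\<And>a. int N dvd int (order a M)"
    "\<And>a. int (order a M) \<le> int N * m (Affine a (b a))" by metis
  obtain U where U: "M = U ^ N" using is_power_if_orders_divisible[OF \<open>M \<noteq> 0\<close> N(2)] b(2) by auto
  have "U \<noteq> 0" using U \<open>M \<noteq> 0\<close> N(2) by auto
  have ord_power: "order a (U ^ n) = n * order a U" for a n
    using \<open>U \<noteq> 0\<close> by (induction n) (simp_all add: order_mult)
  have ord_le: "order a U \<le> card {i\<in>I. Q i = Affine a (b a)}" for a
    using b(3)[of a] m[of a "b a"] b(1) N(2) by (simp add: U ord_power affine_in_curve)
  have fin: "finite {a. poly U a = 0}" using \<open>U \<noteq> 0\<close> by (rule poly_roots_finite)
  have "degree U \<le> (\<Sum>a | poly U a = 0. card {i\<in>I. Q i = Affine a (b a)})"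
    unfolding complex_degree_eq_sum_order[OF \<open>U \<noteq> 0\<close>] by (intro sum_mono ord_le)
  also have "\<dots> = card (\<Union>a\<in>{a. poly U a = 0}. {i\<in>I. Q i = Affine a (b a)})"
    using fin \<open>finite I\<close> by (intro card_UN_disjoint[symmetric]) auto
  also have "\<dots> \<le> card I" using \<open>finite I\<close> by (intro card_mono) auto
  finally have "degree U \<le> card I" .
  with r(1) h(1,4) k3 U[unfolded M_def] show ?thesis
    by (intro exI[of _ r] exI[of _ h] exI[of _ A] exI[of _ B] exI[of _ U] conjI) simp_all
qed

lemma order_linear_prod:
  fixes x :: "'i \<Rightarrow> complex"
  assumes "finite S"
  shows "order a (\<Prod>i\<in>S. [:- x i, 1:]) = card {i\<in>S. x i = a}"
  using assms
proof (induction S rule: finite_induct)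
  case (insert j S)
  have 1: "order a [:- x j, 1:] = (if x j = a then 1 else 0)"
    using order_power_n_n[of a 1] by (auto simp: order_0I)
  have "{i\<in>insert j S. x i = a} = (if x j = a then insert j {i\<in>S. x i = a} else {i\<in>S. x i = a})"
    by auto
  then show ?case
    using insert 1 by (simp add: order_mult prod_zero_iff del: mult_pCons_left)
qed simp

text \<open>
  By symmetry the divisor \<open>\<Sum> (Q i + \<iota> (Q i) - 2 \<infinity>)\<close> of the product is twice \<open>\<Sum> (Q i - \<infinity>)\<close>.
\<close>

lemma valuation_linear_prod:
  assumes Q: "\<And>i. i \<in> I \<Longrightarrow> Q i \<in> hyperelliptic_curve f" and "finite I"
    and sym: "\<And>a b. Affine a b \<in> hyperelliptic_curve f \<Longrightarrow>
      card {i\<in>I. Q i = Affine a b} = card {i\<in>I. Q i = Affine a (- b)}"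
    and P: "P \<in> hyperelliptic_curve f"
  shows "valuation P (of_x (\<Prod>i\<in>{i\<in>I. Q i \<noteq> Infinity}. [:- chart_xi0 (Q i), 1:]))
    = 2 * (int (card {i\<in>I. Q i = P}) - (if P = Infinity then int (card I) else 0))"
proof -
  let ?S = "{i\<in>I. Q i \<noteq> Infinity}"
  let ?G = "\<Prod>i\<in>?S. [:- chart_xi0 (Q i), 1:]"
  have nz: "?G \<noteq> 0" using \<open>finite I\<close> by (simp add: prod_zero_iff)
  show ?thesis
  proof (cases P)
    case Infinity
    have "degree ?G = card ?S" by (subst degree_prod_sum_eq) auto
    moreover have "card I = card ?S + card {i\<in>I. Q i = Infinity}"
      using \<open>finite I\<close> by (subst card_Un_disjoint[symmetric]) (auto intro!: arg_cong[of _ _ card])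
    ultimately show ?thesis using valuation_infinity_of_x[OF nz] Infinity by simp
  next
    case (Affine a b)
    have b: "b ^ 2 = poly f a" using P Affine by (simp add: affine_in_curve)
    have Qi: "Q i = Affine a b \<or> Q i = Affine a (- b)" if "i \<in> ?S" "chart_xi0 (Q i) = a" for i
    proof (cases "Q i")
      case (Affine a' b')
      then have "a' = a" "b' ^ 2 = b ^ 2" using that Q[of i] b by (auto simp: affine_in_curve)
      then show ?thesis using Affine by (auto simp: power2_eq_iff)
    qed (use that in simp)
    have set: "{i\<in>?S. chart_xi0 (Q i) = a} = {i\<in>I. Q i = Affine a b} \<union> {i\<in>I. Q i = Affine a (- b)}"
      using Qi by auto
    have ord: "order a ?G = card {i\<in>?S. chart_xi0 (Q i) = a}" using \<open>finite I\<close> by (intro order_linear_prod) simp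
    have val: "valuation P (of_x ?G) = (if b = 0 then 2 else 1) * int (order a ?G)"
      using valuation_affine_of_x[OF _ nz, of a b] P Affine by simp
    show ?thesis
    proof (cases "b = 0")
      case True
      then show ?thesis unfolding val ord set using Affine by simp
    next
      case False
      then have "card ({i\<in>I. Q i = Affine a b} \<union> {i\<in>I. Q i = Affine a (- b)})
          = card {i\<in>I. Q i = Affine a b} + card {i\<in>I. Q i = Affine a (- b)}"
        using \<open>finite I\<close> by (intro card_Un_disjoint) auto
      then show ?thesis unfolding val ord set using Affine False sym[of a b] P by simp
    qed
  qed
qed

section \<open>Principal divisors and the jacobian\<close>

lemma principal_divisors_iff:
  "D \<in> principal_divisors f \<longleftrightarrow> Poly_Mapping.keys D \<subseteq> hyperelliptic_curve f \<and>
     (\<exists>k\<in>range emb. k \<noteq> 0 \<and> (\<forall>P\<in>hyperelliptic_curve f. Poly_Mapping.lookup D P = valuation P k))"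
proof -
  have "(\<exists>h. h \<noteq> \<zero>\<^bsub>function_field f\<^esub> \<and> (\<forall>P\<in>hyperelliptic_curve f. Poly_Mapping.lookup D P = ord_at f P h))
    \<longleftrightarrow> (\<exists>h. emb h \<noteq> 0 \<and> (\<forall>P\<in>hyperelliptic_curve f. Poly_Mapping.lookup D P = valuation P (emb h)))"
    by (simp add: emb_eq_0_iff ord_at_eq_valuation cong: conj_cong)
  then show ?thesis unfolding principal_divisors_def by auto
qed

lemma subgroup_principal_divisors:
  "subgroup (principal_divisors f) (free_Abelian_group (hyperelliptic_curve f))"
proof
  let ?C = "hyperelliptic_curve f"
  show "principal_divisors f \<subseteq> carrier (free_Abelian_group ?C)" by (auto simp: principal_divisors_def)
  have one: "1 \<in> range emb" using emb_in_range(2)[of 1] by (simp add: of_x_hom)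
  then have "valuation P 1 = 0" if "P \<in> ?C" for P using valuation_mult[OF that one _ one] by simp
  then show "\<one>\<^bsub>free_Abelian_group ?C\<^esub> \<in> principal_divisors f"
    unfolding one_free_Abelian_group principal_divisors_iff using one
    by (intro conjI bexI[of _ 1]) simp_all
  fix D D' assume D: "D \<in> principal_divisors f"
  then obtain k where k: "k \<in> range emb" "k \<noteq> 0" "\<And>P. P \<in> ?C \<Longrightarrow> Poly_Mapping.lookup D P = valuation P k"
    unfolding principal_divisors_iff by blast
  have keys: "Poly_Mapping.keys D \<subseteq> ?C" using D by (simp add: principal_divisors_iff)
  have "- D \<in> principal_divisors f"
    unfolding principal_divisors_iff using keys k range_emb_inverse[OF k(1)] valuation_inverse[OF _ k(1,2)]
    by (intro conjI bexI[of _ "inverse k"]) auto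
  then show "inv\<^bsub>free_Abelian_group ?C\<^esub> D \<in> principal_divisors f" using keys by simp
  assume D': "D' \<in> principal_divisors f"
  then obtain k' where k': "k' \<in> range emb" "k' \<noteq> 0" "\<And>P. P \<in> ?C \<Longrightarrow> Poly_Mapping.lookup D' P = valuation P k'"
    unfolding principal_divisors_iff by blast
  have "Poly_Mapping.keys (D + D') \<subseteq> ?C"
    using keys D' Poly_Mapping.keys_add[of D D'] by (auto simp: principal_divisors_iff)
  then have "D + D' \<in> principal_divisors f"
    unfolding principal_divisors_iff using k k' range_emb_mult[OF k(1) k'(1)] valuation_mult[OF _ k(1,2) k'(1,2)]
    by (intro conjI bexI[of _ "k * k'"]) (auto simp: lookup_add)
  then show "D \<otimes>\<^bsub>free_Abelian_group ?C\<^esub> D' \<in> principal_divisors f" by simp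
qed

end

lemma divisor_degree_add: "divisor_degree (D + D') = divisor_degree D + divisor_degree D'"
proof -
  let ?K = "Poly_Mapping.keys D \<union> Poly_Mapping.keys D'"
  have ext: "divisor_degree E = (\<Sum>P\<in>?K. Poly_Mapping.lookup E P)" if "Poly_Mapping.keys E \<subseteq> ?K" for E
    unfolding divisor_degree_def using that by (intro sum.mono_neutral_left) (auto simp: in_keys_iff)
  show ?thesis
    using ext[of D] ext[of D'] ext[of "D + D'"] Poly_Mapping.keys_add[of D D']
    by (simp add: lookup_add sum.distrib)
qed

lemma divisor_degree_uminus: "divisor_degree (- D) = - divisor_degree D"
  by (simp add: divisor_degree_def sum_negf)

lemma divisor_degree_frag_of: "divisor_degree (frag_of P) = 1"
  by (simp add: divisor_degree_def keys_frag_of)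

lemma carrier_degree_zero_divisors:
  "D \<in> carrier (degree_zero_divisors f) \<longleftrightarrow> Poly_Mapping.keys D \<subseteq> hyperelliptic_curve f \<and> divisor_degree D = 0"
  by (simp add: degree_zero_divisors_def)

lemma subgroup_degree_zero_divisors:
  "subgroup (carrier (degree_zero_divisors f)) (free_Abelian_group (hyperelliptic_curve f))"
proof
  fix D D' assume D: "D \<in> carrier (degree_zero_divisors f)"
  then show "inv\<^bsub>free_Abelian_group (hyperelliptic_curve f)\<^esub> D \<in> carrier (degree_zero_divisors f)"
    by (simp add: carrier_degree_zero_divisors divisor_degree_uminus)
  assume D': "D' \<in> carrier (degree_zero_divisors f)"
  then show "D \<otimes>\<^bsub>free_Abelian_group (hyperelliptic_curve f)\<^esub> D' \<in> carrier (degree_zero_divisors f)"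
    using D Poly_Mapping.keys_add[of D D'] by (auto simp: carrier_degree_zero_divisors divisor_degree_add)
qed (auto simp: carrier_degree_zero_divisors divisor_degree_def)

lemma divisor_class_eq:
  "divisor_class f D = principal_divisors f #>\<^bsub>free_Abelian_group (hyperelliptic_curve f)\<^esub> D"
  by (simp add: divisor_class_def r_coset_def degree_zero_divisors_def)

text \<open>
  This exhibits the jacobian as a subset of the commutative group of all divisors modulo principal ones, the
  image of the divisors of degree zero; it inherits the group laws from there.
\<close>

lemma jacobian_eq:
  "jacobian f = (free_Abelian_group (hyperelliptic_curve f) Mod principal_divisors f)
     \<lparr>carrier := divisor_class f ` carrier (degree_zero_divisors f)\<rparr>"
  unfolding jacobian_def FactGroup_def
  by (auto simp: RCOSETS_def divisor_class_def set_mult_def degree_zero_divisors_def fun_eq_iff)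

context odd_hyperelliptic
begin

lemma normal_principal_divisors:
  "principal_divisors f \<lhd> free_Abelian_group (hyperelliptic_curve f)"
  using comm_group.subgroup_imp_normal[OF abelian_free_Abelian_group subgroup_principal_divisors] .

lemma class_hom:
  "divisor_class f \<in> hom (free_Abelian_group (hyperelliptic_curve f))
     (free_Abelian_group (hyperelliptic_curve f) Mod principal_divisors f)"
  using normal.r_coset_hom_Mod[OF normal_principal_divisors] by (simp add: divisor_class_eq[abs_def])

lemma jacobian_comm_group: "comm_group (jacobian f)"
proof -
  let ?A = "free_Abelian_group (hyperelliptic_curve f)"
  let ?G = "?A Mod principal_divisors f"
  interpret G: comm_group ?G
    using comm_group.abelian_FactGroup[OF abelian_free_Abelian_group subgroup_principal_divisors] .
  interpret h: group_hom ?A ?G "divisor_class f"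
    by (intro group_hom.intro group_hom_axioms.intro class_hom) (simp, rule G.is_group)
  have sub: "subgroup (divisor_class f ` carrier (degree_zero_divisors f)) ?G"
    by (rule h.subgroup_img_is_subgroup[OF subgroup_degree_zero_divisors])
  show ?thesis
    unfolding jacobian_eq
  proof (rule group.group_comm_groupI)
    let ?J = "?G\<lparr>carrier := divisor_class f ` carrier (degree_zero_divisors f)\<rparr>"
    show "group ?J" by (rule G.subgroup_imp_group[OF sub])
    fix z w assume "z \<in> carrier ?J" "w \<in> carrier ?J"
    then have "z \<in> carrier ?G" "w \<in> carrier ?G" using subgroup.mem_carrier[OF sub] by simp_all
    then show "z \<otimes>\<^bsub>?J\<^esub> w = w \<otimes>\<^bsub>?J\<^esub> z" using G.m_comm[of z w] by simp
  qed
qed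

lemma jacobian_mult:
  assumes "D \<in> carrier (degree_zero_divisors f)" "D' \<in> carrier (degree_zero_divisors f)"
  shows "divisor_class f D \<otimes>\<^bsub>jacobian f\<^esub> divisor_class f D' = divisor_class f (D + D')"
  using hom_mult[OF class_hom, of D D'] assms by (simp add: jacobian_eq carrier_degree_zero_divisors)

lemma class_in_jacobian: "D \<in> carrier (degree_zero_divisors f) \<Longrightarrow> divisor_class f D \<in> carrier (jacobian f)"
  by (simp add: jacobian_eq)

lemma class_eq_one_iff:
  assumes "Poly_Mapping.keys D \<subseteq> hyperelliptic_curve f"
  shows "divisor_class f D = \<one>\<^bsub>jacobian f\<^esub> \<longleftrightarrow> D \<in> principal_divisors f"
proof -
  have one: "\<one>\<^bsub>jacobian f\<^esub> = principal_divisors f" by (simp add: jacobian_def)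
  show ?thesis
    unfolding one divisor_class_eq
    using group.coset_join1[OF group_free_Abelian_group _ _ subgroup_principal_divisors]
      group.coset_join2[OF group_free_Abelian_group _ subgroup_principal_divisors] assms by auto
qed

lemma zero_divisor_carrier:
  "0 \<in> carrier (degree_zero_divisors f)"
  "D \<in> carrier (degree_zero_divisors f) \<Longrightarrow> D' \<in> carrier (degree_zero_divisors f) \<Longrightarrow>
     D + D' \<in> carrier (degree_zero_divisors f)"
  using subgroup.one_closed[OF subgroup_degree_zero_divisors] subgroup.m_closed[OF subgroup_degree_zero_divisors]
  by auto

lemma class_zero: "divisor_class f 0 = \<one>\<^bsub>jacobian f\<^esub>"
  using class_eq_one_iff[of 0] subgroup.one_closed[OF subgroup_principal_divisors] by simp

lemma finprod_class:
  assumes "finite I" "\<And>i. i \<in> I \<Longrightarrow> D i \<in> carrier (degree_zero_divisors f)"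
  shows "finprod (jacobian f) (\<lambda>i. divisor_class f (D i)) I = divisor_class f (\<Sum>i\<in>I. D i)
    \<and> (\<Sum>i\<in>I. D i) \<in> carrier (degree_zero_divisors f)"
  using assms
proof (induction I rule: finite_induct)
  case empty
  interpret comm_group "jacobian f" by (rule jacobian_comm_group)
  show ?case by (simp add: class_zero zero_divisor_carrier)
next
  case (insert i I)
  interpret comm_group "jacobian f" by (rule jacobian_comm_group)
  show ?case using insert
    by (subst finprod_insert) (auto simp: class_in_jacobian jacobian_mult zero_divisor_carrier)
qed

lemma pow_class:
  fixes n :: nat
  assumes "D \<in> carrier (degree_zero_divisors f)"
  shows "divisor_class f D [^]\<^bsub>jacobian f\<^esub> n = divisor_class f (frag_cmul (int n) D)
    \<and> frag_cmul (int n) D \<in> carrier (degree_zero_divisors f)"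
proof (induction n)
  case 0
  interpret comm_group "jacobian f" by (rule jacobian_comm_group)
  show ?case by (simp add: class_zero zero_divisor_carrier)
next
  case (Suc n)
  interpret comm_group "jacobian f" by (rule jacobian_comm_group)
  have "frag_cmul (int (Suc n)) D = frag_cmul (int n) D + D" by (simp add: frag_cmul_distrib add.commute)
  then show ?case using Suc assms jacobian_mult zero_divisor_carrier(2) by simp
qed

end

section \<open>Torsion points on a generic curve\<close>

text \<open>
  Distinct roots are simple.
\<close>

lemma odd_hyperelliptic_prod:
  fixes x :: "'i \<Rightarrow> complex"
  assumes "finite I" "odd (card I)" and inj: "inj_on x I"
  shows "odd_hyperelliptic (\<Prod>i\<in>I. [:- x i, 1:])"
proof
  show "odd (degree (\<Prod>i\<in>I. [:- x i, 1:]))"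
    using assms(2) by (subst degree_prod_sum_eq) auto
  fix a assume root: "poly (\<Prod>i\<in>I. [:- x i, 1:]) a = 0"
  have "poly (\<Prod>i\<in>I. [:- x i, 1:]) a = (\<Prod>i\<in>I. a - x i)"
    unfolding poly_prod by (intro prod.cong) simp_all
  then obtain k where k: "k \<in> I" "a = x k" using root \<open>finite I\<close> by (auto simp: prod_zero_iff)
  let ?f1 = "\<Prod>i\<in>I - {k}. [:- x i, 1:]"
  have "(\<Prod>i\<in>I. [:- x i, 1:]) = [:- x k, 1:] * ?f1"
    by (rule prod.remove) (use k \<open>finite I\<close> in auto)
  moreover have "poly ?f1 (x k) \<noteq> 0"
    using k inj \<open>finite I\<close> by (auto simp: poly_prod inj_on_def)
  ultimately show "\<exists>f1. (\<Prod>i\<in>I. [:- x i, 1:]) = [:- a, 1:] * f1 \<and> poly f1 a \<noteq> 0" using k(2) by blast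
qed

text \<open>
  A function whose divisor is an even multiple of \<open>D\<close> depends on \<open>x\<close> only, by the Pell equation; so \<open>D\<close> is
  symmetric under \<open>\<iota>\<close>, and \<open>2 D\<close> is principal.
\<close>

theorem generic_torsion_in_theta:
  fixes g d :: nat and \<alpha> :: "nat \<Rightarrow> complex" and f :: "complex poly"
  assumes ind: "algebraically_independent {1..2 * g + 1} \<alpha>"
    and f: "f = (\<Prod>i\<in>{1..2 * g + 1}. [:- \<alpha> i, 1:])" and "d < g"
    and z: "z \<in> Theta f d" and tors: "group.ord (jacobian f) z > 0"
  shows "group (jacobian f) \<and> z \<in> carrier (jacobian f) \<and> z [^]\<^bsub>jacobian f\<^esub> (2::nat) = \<one>\<^bsub>jacobian f\<^esub>"
proof -
  interpret odd_hyperelliptic f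
    unfolding f by (rule odd_hyperelliptic_prod) (use algebraically_independent_inj_on[OF ind] in simp_all)
  interpret J: comm_group "jacobian f" by (rule jacobian_comm_group)
  let ?C = "hyperelliptic_curve f"
  have inf: "Infinity \<in> ?C" by (simp add: hyperelliptic_curve_def)
  obtain Q where Q: "Q \<in> {1..d} \<rightarrow> ?C" and z': "z = finprod (jacobian f) (\<lambda>i. curve_embedding f (Q i)) {1..d}"
    using z unfolding Theta_def by blast
  define D where "D = (\<Sum>i\<in>{1..d}. frag_of (Q i) - frag_of Infinity)"
  have Di: "frag_of (Q i) - frag_of Infinity \<in> carrier (degree_zero_divisors f)" if "i \<in> {1..d}" for i
  proof -
    have "Poly_Mapping.keys (frag_of (Q i) - frag_of Infinity) \<subseteq> ?C"
      using keys_diff[of "frag_of (Q i)" "frag_of Infinity"] Q that inf by (auto simp: keys_frag_of)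
    then show ?thesis
      using divisor_degree_add[of "frag_of (Q i)" "- frag_of Infinity"]
      by (simp add: carrier_degree_zero_divisors divisor_degree_uminus divisor_degree_frag_of)
  qed
  have zD: "z = divisor_class f D" and D0: "D \<in> carrier (degree_zero_divisors f)"
    using finprod_class[of "{1..d}" "\<lambda>i. frag_of (Q i) - frag_of Infinity"] Di
    by (simp_all add: z' D_def curve_embedding_def)
  have keys: "Poly_Mapping.keys D \<subseteq> ?C" using D0 by (simp add: carrier_degree_zero_divisors)
  have zJ: "z \<in> carrier (jacobian f)" using zD D0 class_in_jacobian by simp
  have lookup: "Poly_Mapping.lookup D P
      = int (card {i\<in>{1..d}. Q i = P}) - (if P = Infinity then int (card {1..d}) else 0)" for P
  proof -
    have "Poly_Mapping.lookup D P = (\<Sum>i\<in>{1..d}. (if Q i = P then 1 else 0) - (if P = Infinity then 1 else 0))"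
      unfolding D_def lookup_sum by (intro sum.cong refl) (auto simp: lookup_minus)
    then show ?thesis by (simp add: sum_subtractf sum.If_cases Int_def)
  qed
  define n where "n = group.ord (jacobian f) z"
  have "n > 0" using tors by (simp add: n_def)
  have "z [^]\<^bsub>jacobian f\<^esub> n = \<one>\<^bsub>jacobian f\<^esub>" unfolding n_def by (rule J.pow_ord_eq_1[OF zJ])
  then have "frag_cmul (int n) D \<in> principal_divisors f"
    using pow_class[OF D0, of n] class_eq_one_iff[of "frag_cmul (int n) D"] keys keys_cmul[of "int n" D] zD by auto
  then obtain k where k: "k \<in> range emb" "k \<noteq> 0"
    "\<forall>P\<in>?C. Poly_Mapping.lookup (frag_cmul (int n) D) P = valuation P k"
    unfolding principal_divisors_iff by blast
  \<comment> \<open>squaring makes the multiple of \<open>D\<close> even, also for torsion of odd order\<close>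
  have kk: "k * k \<in> range emb" "k * k \<noteq> 0" using k(1,2) range_emb_mult by auto
  have val: "valuation P (k * k) = int (2 * n) * Poly_Mapping.lookup D P" if "P \<in> ?C" for P
    using valuation_mult[OF that k(1,2) k(1,2)] k(3) that by simp
  obtain r h A B U where r: "r \<noteq> 0" "h \<noteq> 0" "k * k * of_x r = of_x h * (of_x A + of_x B * y)"
    "\<And>a. \<not> (poly A a = 0 \<and> poly B a = 0)" "A ^ 2 - f * B ^ 2 = U ^ (2 * n)" "degree U \<le> card {1..d}"
    using norm_is_power[OF kk _ _ val, of "{1..d}" Q] \<open>n > 0\<close> lookup by (auto simp del: One_nat_def)
  have "degree U < g" using r(6) \<open>d < g\<close> by simp
  then have "B = 0" using generic_pell_equation[OF ind f r(5) _ _ r(4)] \<open>n > 0\<close> by simp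
  have "A \<noteq> 0" using r(4) \<open>B = 0\<close> by auto
  have kk_eq: "k * k * of_x r = of_x (h * A)" using r(3) \<open>B = 0\<close> by (simp add: of_x_hom)
  have sym: "card {i\<in>{1..d}. Q i = Affine a b} = card {i\<in>{1..d}. Q i = Affine a (- b)}"
    if P: "Affine a b \<in> ?C" for a b
  proof -
    have P': "Affine a (- b) \<in> ?C" using P by (simp add: affine_in_curve)
    have "valuation R (k * k) + valuation R (of_x r) = valuation R (of_x (h * A))" if "R \<in> ?C" for R
      using valuation_mult[OF that kk emb_in_range(2), of r] r(1) by (simp add: kk_eq)
    from this[OF P] this[OF P'] have "valuation (Affine a b) (k * k) = valuation (Affine a (- b)) (k * k)"
      using valuation_affine_of_x[OF P] valuation_affine_of_x[OF P'] r(1,2) \<open>A \<noteq> 0\<close> by simp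
    then show ?thesis using val[OF P] val[OF P'] lookup \<open>n > 0\<close> by simp
  qed
  define G where "G = (\<Prod>i\<in>{i\<in>{1..d}. Q i \<noteq> Infinity}. [:- chart_xi0 (Q i), 1:])"
  have "G \<noteq> 0" by (simp add: G_def prod_zero_iff)
  have "valuation P (of_x G) = 2 * Poly_Mapping.lookup D P" if "P \<in> ?C" for P
    unfolding G_def lookup by (rule valuation_linear_prod) (use Q sym that in auto)
  then have "frag_cmul (int 2) D \<in> principal_divisors f"
    unfolding principal_divisors_iff using keys keys_cmul[of 2 D] emb_in_range(2)[of G] \<open>G \<noteq> 0\<close>
    by (intro conjI bexI[of _ "of_x G"]) auto
  then have "z [^]\<^bsub>jacobian f\<^esub> (2::nat) = \<one>\<^bsub>jacobian f\<^esub>"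
    using pow_class[OF D0, of 2] class_eq_one_iff[of "frag_cmul (int 2) D"] zD
    by (simp add: carrier_degree_zero_divisors)
  then show ?thesis using zJ J.is_group by blast
qed

theorem theorem5p3:
  fixes g :: nat and \<alpha> :: "nat \<Rightarrow> complex" and f :: "complex poly"
  assumes "g > 1"
    and "algebraically_independent {1..2 * g + 1} \<alpha>"
    and "f = (\<Prod>i\<in>{1..2 * g + 1}. [:- \<alpha> i, 1:])"
  shows "(\<not> (\<exists>z \<in> Theta f (2 * g div 3). z \<noteq> \<one>\<^bsub>jacobian f\<^esub> \<and> odd (group.ord (jacobian f) z)))
       \<and> (\<forall>z \<in> Theta f (g div 2). (\<exists>k. group.ord (jacobian f) z = 2 ^ k) \<longrightarrow>
            group.ord (jacobian f) z = 1 \<or> group.ord (jacobian f) z = 2)"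
proof -
  have two_torsion: "group (jacobian f) \<and> z \<in> carrier (jacobian f) \<and> group.ord (jacobian f) z dvd 2"
    if "z \<in> Theta f d" "d < g" "group.ord (jacobian f) z > 0" for z d
    using generic_torsion_in_theta[OF assms(2,3) that(2,1,3)] group.pow_eq_id by metis
  have "z = \<one>\<^bsub>jacobian f\<^esub>" if "z \<in> Theta f (2 * g div 3)" "odd (group.ord (jacobian f) z)" for z
  proof -
    have "2 * g div 3 < g" using \<open>g > 1\<close> by linarith
    then have *: "group (jacobian f)" "z \<in> carrier (jacobian f)" "group.ord (jacobian f) z dvd 2"
      using two_torsion[OF that(1) _ odd_pos[OF that(2)]] by blast+
    have "group.ord (jacobian f) z \<le> 2" using *(3) by (rule dvd_imp_le) simp
    then have "group.ord (jacobian f) z = 1" using that(2) by presburger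
    then show ?thesis using group.ord_eq_1[OF *(1,2)] by blast
  qed
  moreover have "group.ord (jacobian f) z = 1 \<or> group.ord (jacobian f) z = 2"
    if "z \<in> Theta f (g div 2)" "group.ord (jacobian f) z = 2 ^ k" for z k
  proof -
    have "g div 2 < g" "group.ord (jacobian f) z > 0" using \<open>g > 1\<close> that(2) by simp_all
    then have "group.ord (jacobian f) z dvd 2" using two_torsion[OF that(1)] by blast
    then have "group.ord (jacobian f) z \<le> 2" by (rule dvd_imp_le) simp
    with \<open>group.ord (jacobian f) z > 0\<close> show ?thesis by linarith
  qed
  ultimately show ?thesis by blast
qed

end
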